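(* Let $\mathcal{L}$ be a computable linear order of order-type $\omega$, and let $C\subseteq\mathbb{N}$ be a co-c.e. cohesive set. Then the finite condensation $c_F(\Pi_C\mathcal{L})$ of the cohesive power $\Pi_C\mathcal{L}$ has order-type $\mathbf{1}+\eta$.
   Context: A set $C\subseteq\mathbb{N}$ is cohesive if it is infinite and for every c.e. set $W$, either $C\setminus W$ or $C\cap W$ is finite; co-c.e. means $\mathbb{N}\setminus C$ is c.e. Write $X\subseteq^* Y$ if $X\setminus Y$ is finite. A computable linear order $\mathcal{L}=(L,\prec_{\mathcal{L}})$ has computable domain $L\subseteq\mathbb{N}$ and computable order. The cohesive power $\Pi_C\mathcal{L}$ has as elements the classes $[\varphi]$ of partial computable $\varphi\colon\mathbb{N}\to L$ with $C\subseteq^*\mathrm{dom}(\varphi)$ under the equivalence $\varphi=_C\psi$ iff $C\subseteq^*\{x:\varphi(x)\downarrow=\psi(x)\downarrow\}$, ordered by $[\varphi]\prec[\psi]$ iff $C\subseteq^*\{x:\varphi(x)\downarrow,\psi(x)\downarrow,\varphi(x)\prec_{\mathcal{L}}\psi(x)\}$. For a linear order $\mathcal{M}$ and an element $x$, $c_F(x)$ is the set of $y$ such that the closed interval between $x$ and $y$ is finite; these sets partition $\mathcal{M}$ into intervals, and the finite condensation $c_F(\mathcal{M})$ is the set of these intervals ordered by $I<J$ iff every element of $I$ is below every element of $J$. $\mathbf{1}$ is the one-point order and $\eta$ the order-type of the rationals. *)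

theory Defs
  imports Complex_Main
begin

section \<open>Partial computable functions\<close>

text \<open>
  Programs for the partial recursive functions. Arities are not recorded in the syntax: a program
  is run on a list of arguments, and a program whose parts do not fit the length of that list has
  no value there. For each fixed arity this gives exactly the usual partial recursive functions.
\<close>

datatype recf =
    Zero
  | Succ
  | Proj nat
  | Comp recf "recf list"
  | PrimRec recf recf
  | Mu recf

inductive eval :: "recf \<Rightarrow> nat list \<Rightarrow> nat \<Rightarrow> bool" where
  Zero: "eval Zero xs 0"
| Succ: "eval Succ [x] (Suc x)"
| Proj: "i < length xs \<Longrightarrow> eval (Proj i) xs (xs ! i)"
| Comp: "list_all2 (\<lambda>g y. eval g xs y) gs ys \<Longrightarrow> eval f ys z \<Longrightarrow> eval (Comp f gs) xs z"
| PrimRec_0: "eval f xs y \<Longrightarrow> eval (PrimRec f g) (0 # xs) y"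
| PrimRec_Suc: "eval (PrimRec f g) (n # xs) y \<Longrightarrow> eval g (n # y # xs) z
    \<Longrightarrow> eval (PrimRec f g) (Suc n # xs) z"
| Mu: "eval f (n # xs) 0 \<Longrightarrow> (\<And>m. m < n \<Longrightarrow> \<exists>y>0. eval f (m # xs) y) \<Longrightarrow> eval (Mu f) xs n"
monos list_all2_mono

inductive_cases eval_ZeroE: "eval Zero xs z"
inductive_cases eval_SuccE: "eval Succ xs z"
inductive_cases eval_ProjE: "eval (Proj i) xs z"
inductive_cases eval_CompE: "eval (Comp f gs) xs z"
inductive_cases eval_PrimRec_0E: "eval (PrimRec f g) (0 # xs) z"
inductive_cases eval_PrimRec_SucE: "eval (PrimRec f g) (Suc n # xs) z"
inductive_cases eval_MuE: "eval (Mu f) xs z"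

lemma eval_deterministic: "eval f xs y \<Longrightarrow> eval f xs z \<Longrightarrow> y = z"
proof (induction f xs y arbitrary: z rule: eval.induct)
  case (Zero xs)
  from Zero.prems have "z = 0" by (rule eval_ZeroE)
  then show ?case by simp
next
  case (Succ x)
  then show ?case by (auto elim: eval_SuccE)
next
  case (Proj i xs)
  from Proj.prems show ?case by (auto elim: eval_ProjE)
next
  case (Comp xs gs ys f y)
  from Comp.prems obtain ys' where *: "list_all2 (\<lambda>g. eval g xs) gs ys'" "eval f ys' z"
    by (rule eval_CompE)
  have "ys = ys'"
  proof (rule nth_equalityI)
    show "length ys = length ys'"
      using list_all2_lengthD[OF Comp.IH(1)] list_all2_lengthD[OF *(1)] by simp
    fix i assume "i < length ys"
    moreover from this have "i < length gs"
      using list_all2_lengthD[OF Comp.IH(1)] by simp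
    ultimately show "ys ! i = ys' ! i"
      using list_all2_nthD[OF Comp.IH(1)] list_all2_nthD[OF *(1)] by blast
  qed
  then show ?case using Comp.IH(2) *(2) by simp
next
  case (PrimRec_0 f xs y g)
  from PrimRec_0.prems have "eval f xs z" by (rule eval_PrimRec_0E)
  then show ?case by (rule PrimRec_0.IH)
next
  case (PrimRec_Suc f g n xs y w)
  from PrimRec_Suc.prems obtain y' where
    *: "eval (PrimRec f g) (n # xs) y'" "eval g (n # y' # xs) z"
    by (rule eval_PrimRec_SucE)
  from PrimRec_Suc.IH(1)[OF *(1)] have "y = y'" .
  with *(2) show ?case by (simp add: PrimRec_Suc.IH(2))
next
  case (Mu f n xs)
  from Mu.prems have z: "eval f (z # xs) 0" "\<And>m. m < z \<Longrightarrow> \<exists>y>0. eval f (m # xs) y"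
    using eval_MuE by blast+
  have "\<not> n < z"
  proof
    assume "n < z"
    from z(2)[OF this] obtain y where "y > 0" "eval f (n # xs) y" by blast
    with Mu.IH(1)[of y] show False by simp
  qed
  moreover have "\<not> z < n"
  proof
    assume "z < n"
    from Mu.IH(2)[OF this] obtain y where "y > 0" "\<forall>w. eval f (z # xs) w \<longrightarrow> y = w" by blast
    with z(1) show False by (metis less_irrefl)
  qed
  ultimately show ?case by simp
qed

text \<open>A partial function is rendered as an option-valued function; \<open>None\<close> means divergence.\<close>

definition partial_computable :: "(nat \<Rightarrow> nat option) \<Rightarrow> bool" where
  "partial_computable \<phi> \<longleftrightarrow> (\<exists>f. \<forall>x y. eval f [x] y \<longleftrightarrow> \<phi> x = Some y)"

definition ce_set :: "nat set \<Rightarrow> bool" where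
  "ce_set W \<longleftrightarrow> (\<exists>\<phi>. partial_computable \<phi> \<and> W = dom \<phi>)"

definition computable_set :: "nat set \<Rightarrow> bool" where
  "computable_set A \<longleftrightarrow> (\<exists>f. \<forall>x. eval f [x] (if x \<in> A then 1 else 0))"

definition computable_rel :: "nat rel \<Rightarrow> bool" where
  "computable_rel R \<longleftrightarrow> (\<exists>f. \<forall>x y. eval f [x, y] (if (x, y) \<in> R then 1 else 0))"

definition almost_subset :: "'a set \<Rightarrow> 'a set \<Rightarrow> bool"  (infix "\<subseteq>*" 50) where
  "X \<subseteq>* Y \<longleftrightarrow> finite (X - Y)"

definition cohesive :: "nat set \<Rightarrow> bool" where
  "cohesive C \<longleftrightarrow> infinite C \<and> (\<forall>W. ce_set W \<longrightarrow> finite (C - W) \<or> finite (C \<inter> W))"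

definition co_ce_set :: "nat set \<Rightarrow> bool" where
  "co_ce_set C \<longleftrightarrow> ce_set (- C)"


section \<open>Linear orders\<close>

text \<open>An order is a set together with its strict order relation.\<close>

record 'a lorder =
  elems :: "'a set"
  less_rel :: "'a rel"

definition linear_lorder :: "'a lorder \<Rightarrow> bool" where
  "linear_lorder M \<longleftrightarrow> less_rel M \<subseteq> elems M \<times> elems M \<and> strict_linear_order_on (elems M) (less_rel M)"

definition same_order_type :: "'a lorder \<Rightarrow> 'b lorder \<Rightarrow> bool"  (infix "\<cong>" 50) where
  "M \<cong> N \<longleftrightarrow> (\<exists>f. bij_betw f (elems M) (elems N) \<and>
     (\<forall>x\<in>elems M. \<forall>y\<in>elems M. (x, y) \<in> less_rel M \<longleftrightarrow> (f x, f y) \<in> less_rel N))"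

definition omega_order :: "nat lorder"  ("\<omega>") where
  "\<omega> = \<lparr>elems = UNIV, less_rel = {(x, y). x < y}\<rparr>"

definition eta_order :: "rat lorder"  ("\<eta>") where
  "\<eta> = \<lparr>elems = UNIV, less_rel = {(x, y). x < y}\<rparr>"

definition one_order :: "unit lorder"  ("\<^bold>1") where
  "\<^bold>1 = \<lparr>elems = {()}, less_rel = {}\<rparr>"

definition order_sum :: "'a lorder \<Rightarrow> 'b lorder \<Rightarrow> ('a + 'b) lorder"  (infixl "\<^bold>+" 65) where
  "M \<^bold>+ N = \<lparr>elems = elems M <+> elems N,
     less_rel = {(Inl x, Inl y) | x y. (x, y) \<in> less_rel M}
              \<union> {(Inl x, Inr y) | x y. x \<in> elems M \<and> y \<in> elems N}
              \<union> {(Inr x, Inr y) | x y. (x, y) \<in> less_rel N}\<rparr>"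

definition computable_linear_order :: "nat lorder \<Rightarrow> bool" where
  "computable_linear_order L \<longleftrightarrow>
     linear_lorder L \<and> computable_set (elems L) \<and> computable_rel (less_rel L)"


section \<open>Finite condensation\<close>

text \<open>
  The closed interval between \<open>x\<close> and \<open>y\<close>, whichever of the two is the smaller one.
\<close>

definition closed_interval :: "'a lorder \<Rightarrow> 'a \<Rightarrow> 'a \<Rightarrow> 'a set" where
  "closed_interval M x y = {z \<in> elems M.
     ((x, z) \<in> (less_rel M)\<^sup>= \<and> (z, y) \<in> (less_rel M)\<^sup>=) \<or>
     ((y, z) \<in> (less_rel M)\<^sup>= \<and> (z, x) \<in> (less_rel M)\<^sup>=)}"

definition block :: "'a lorder \<Rightarrow> 'a \<Rightarrow> 'a set" where
  "block M x = {y \<in> elems M. finite (closed_interval M x y)}"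

definition finite_condensation :: "'a lorder \<Rightarrow> 'a set lorder"  ("c\<^sub>F") where
  "c\<^sub>F M = \<lparr>elems = block M ` elems M,
     less_rel = {(I, J). I \<in> block M ` elems M \<and> J \<in> block M ` elems M \<and>
                         (\<forall>x\<in>I. \<forall>y\<in>J. (x, y) \<in> less_rel M)}\<rparr>"


section \<open>Cohesive powers\<close>

definition power_funs :: "nat set \<Rightarrow> nat lorder \<Rightarrow> (nat \<Rightarrow> nat option) set" where
  "power_funs C L = {\<phi>. partial_computable \<phi> \<and> ran \<phi> \<subseteq> elems L \<and> C \<subseteq>* dom \<phi>}"

definition power_eq :: "nat set \<Rightarrow> nat lorder \<Rightarrow> (nat \<Rightarrow> nat option) rel" where
  "power_eq C L = {(\<phi>, \<psi>). \<phi> \<in> power_funs C L \<and> \<psi> \<in> power_funs C L \<and>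
     C \<subseteq>* {x. \<exists>a. \<phi> x = Some a \<and> \<psi> x = Some a}}"

lemma equiv_power_eq: "equiv (power_funs C L) (power_eq C L)"
proof (rule equivI)
  show "power_eq C L \<subseteq> power_funs C L \<times> power_funs C L"
    by (auto simp: power_eq_def)
  show "refl_on (power_funs C L) (power_eq C L)"
    by (auto simp: refl_on_def power_eq_def power_funs_def almost_subset_def dom_def)
  show "sym (power_eq C L)"
    by (auto simp: sym_def power_eq_def conj_commute)
  show "trans (power_eq C L)"
  proof (rule transI)
    fix \<phi> \<psi> \<theta> assume *: "(\<phi>, \<psi>) \<in> power_eq C L" "(\<psi>, \<theta>) \<in> power_eq C L"
    let ?S = "\<lambda>\<phi> \<psi>. {x. \<exists>a. \<phi> x = Some a \<and> \<psi> x = Some (a::nat)}"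
    have "finite ((C - ?S \<phi> \<psi>) \<union> (C - ?S \<psi> \<theta>))"
      using * by (simp add: power_eq_def almost_subset_def)
    then have "C \<subseteq>* ?S \<phi> \<theta>"
      unfolding almost_subset_def by (rule rev_finite_subset) auto
    then show "(\<phi>, \<theta>) \<in> power_eq C L"
      using * by (simp add: power_eq_def)
  qed
qed

definition power_less :: "nat set \<Rightarrow> nat lorder \<Rightarrow> (nat \<Rightarrow> nat option) \<Rightarrow> (nat \<Rightarrow> nat option) \<Rightarrow> bool" where
  "power_less C L \<phi> \<psi> \<longleftrightarrow>
     C \<subseteq>* {x. \<exists>a b. \<phi> x = Some a \<and> \<psi> x = Some b \<and> (a, b) \<in> less_rel L}"

lemma power_less_cong:
  assumes "(\<phi>, \<phi>') \<in> power_eq C L" "(\<psi>, \<psi>') \<in> power_eq C L" "power_less C L \<phi> \<psi>"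
  shows "power_less C L \<phi>' \<psi>'"
proof -
  let ?S = "\<lambda>\<phi> \<psi>. {x. \<exists>a. \<phi> x = Some a \<and> \<psi> x = Some (a::nat)}"
  let ?R = "\<lambda>\<phi> \<psi>. {x. \<exists>a b. \<phi> x = Some a \<and> \<psi> x = Some b \<and> (a, b) \<in> less_rel L}"
  have "finite ((C - ?S \<phi> \<phi>') \<union> (C - ?S \<psi> \<psi>') \<union> (C - ?R \<phi> \<psi>))"
    using assms by (simp add: power_eq_def power_less_def almost_subset_def)
  moreover have "C - ?R \<phi>' \<psi>' \<subseteq> (C - ?S \<phi> \<phi>') \<union> (C - ?S \<psi> \<psi>') \<union> (C - ?R \<phi> \<psi>)"
    by auto
  ultimately show ?thesis
    unfolding power_less_def almost_subset_def by (rule rev_finite_subset)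
qed

text \<open>
  By the previous lemma it makes no difference which representatives of the two classes
  are compared.
\<close>

definition cohesive_power :: "nat set \<Rightarrow> nat lorder \<Rightarrow> (nat \<Rightarrow> nat option) set lorder" where
  "cohesive_power C L = \<lparr>elems = power_funs C L // power_eq C L,
     less_rel = {(X, Y). X \<in> power_funs C L // power_eq C L \<and> Y \<in> power_funs C L // power_eq C L \<and>
                         (\<exists>\<phi>\<in>X. \<exists>\<psi>\<in>Y. power_less C L \<phi> \<psi>)}\<rparr>"

end

theory Submission
  imports Defs "HOL-Library.Countable_Set"
begin

text \<open>
Let \<open>rank\<close> be the isomorphism from \<open>L\<close> to \<open>\<omega>\<close>. Two elements of the cohesive power lie in
  different blocks iff, for each \<open>k\<close>, the ranks of their representatives differ by more than \<open>k\<close> at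
  almost all \<open>n \<in> C\<close>. Density of the condensation therefore asks for a partial computable \<open>\<theta>\<close> with
  \<open>\<phi> n + k < \<theta> n\<close> and \<open>\<theta> n + k < \<psi> n\<close> (in terms of ranks) for every \<open>k\<close> and almost all \<open>n \<in> C\<close>, and
  the absence of a greatest block for a similar \<open>\<theta>\<close> above a given \<open>\<phi>\<close>. Both are obtained from a
  saturation property of co-c.e. cohesive sets: if semidecidable conditions \<open>R 0\<close>, \<open>R 1\<close>, ..., each
  implied by the next, can each be satisfied at almost all \<open>n \<in> C\<close>, then a single partial computable
  function satisfies each of them at almost all \<open>n \<in> C\<close>. The blocks thus form a countable dense order
  with a least element, the block of a constant function, and no greatest one; Cantor's theorem
  identifies it.
\<close>

section \<open>Total computable functions and predicates\<close>

text \<open>The obstacle is that only the order of \<open>L\<close> is given as computable: neither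
  \<open>rank\<close> nor the immediate successor in \<open>L\<close> need be. That two ranks differ
  by more than \<open>k\<close> can therefore only be confirmed by a search for \<open>k\<close>
  elements in between. Such conditions are semidecidable, so the intermediate functions come from
  uniformizing \<open>sigma1\<close> predicates. Semidecidability is also what lets cohesiveness
  act. For fixed \<open>k\<close>, the arguments at which the gap exceeds \<open>k\<close> form a
  c.e. set up to finitely many elements of \<open>C\<close>; hence a gap that is not eventually
  above \<open>k\<close> is eventually at most \<open>k\<close>. This turns the failure of an
  unbounded distance into one uniform bound, and a uniform bound makes the interval in the power
  finite. Conversely, an unbounded distance can be split again and again, so the interval is
  infinite. That \<open>C\<close> is co-c.e. enters the saturation argument: false candidates for
  membership in \<open>C\<close> are recognised at some finite stage, although true ones are never
  confirmed.\<close>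

text \<open>Arguments are given by an environment of which only the first \<open>n\<close> entries are read. Binding a
  variable shifts the environment, so the body of a bounded quantifier, a sum or a minimization
  appears in the form \<open>P (e 0) (\<lambda>i. e (Suc i))\<close>.\<close>

definition computable_fun :: "nat \<Rightarrow> ((nat \<Rightarrow> nat) \<Rightarrow> nat) \<Rightarrow> bool" where
  "computable_fun n F \<longleftrightarrow> (\<exists>f. \<forall>e. eval f (map e [0..<n]) (F e))"

definition computable_pred :: "nat \<Rightarrow> ((nat \<Rightarrow> nat) \<Rightarrow> bool) \<Rightarrow> bool" where
  "computable_pred n P \<longleftrightarrow> computable_fun n (\<lambda>e. if P e then 1 else 0)"

lemma computable_fun_var: "i < n \<Longrightarrow> computable_fun n (\<lambda>e. e i)"
  unfolding computable_fun_def using eval.Proj[of i "map _ [0..<n]"] by (intro exI[of _ "Proj i"]) auto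

text \<open>One rule for composition, weakening and permutation of variables: \<open>G\<close> lists
  the entries of the new environment. Later uses build \<open>G\<close> from nested
  \<open>case_nat\<close>, one level for each leading entry.\<close>

lemma computable_fun_subst:
  assumes F: "computable_fun k F" and G: "\<And>i. i < k \<Longrightarrow> computable_fun n (G i)"
  shows "computable_fun n (\<lambda>e. F (\<lambda>i. G i e))"
proof -
  obtain f where f: "\<And>e. eval f (map e [0..<k]) (F e)"
    using F unfolding computable_fun_def by blast
  have "\<forall>i. \<exists>h. i < k \<longrightarrow> (\<forall>e. eval h (map e [0..<n]) (G i e))"
    using G unfolding computable_fun_def by blast
  then obtain h where h: "\<And>i e. i < k \<Longrightarrow> eval (h i) (map e [0..<n]) (G i e)"
    by metis
  have "eval (Comp f (map h [0..<k])) (map e [0..<n]) (F (\<lambda>i. G i e))" for e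
    by (rule eval.Comp[OF _ f[of "\<lambda>i. G i e"]]) (auto simp: list_all2_conv_all_nth h)
  then show ?thesis unfolding computable_fun_def by blast
qed

lemma computable_fun_comp1:
  assumes "computable_fun 1 (\<lambda>e. g (e 0))" "computable_fun n A"
  shows "computable_fun n (\<lambda>e. g (A e))"
  using computable_fun_subst[OF assms(1), of n "\<lambda>_. A"] assms(2) by simp

lemma computable_fun_comp2:
  assumes "computable_fun 2 (\<lambda>e. g (e 0) (e 1))" "computable_fun n A" "computable_fun n B"
  shows "computable_fun n (\<lambda>e. g (A e) (B e))"
proof -
  have "computable_fun n ([A, B] ! i)" if "i < 2" for i
    using that assms(2,3) by (auto simp: less_2_cases_iff)
  from computable_fun_subst[where G = "\<lambda>i. [A, B] ! i", OF assms(1) this] show ?thesis by simp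
qed

lemma computable_fun_Suc: "computable_fun n A \<Longrightarrow> computable_fun n (\<lambda>e. Suc (A e))"
  by (rule computable_fun_comp1[where g = Suc])
    (auto simp: computable_fun_def intro!: exI[of _ Succ] eval.Succ)

lemma computable_fun_const: "computable_fun n (\<lambda>e. c)"
proof (induction c)
  case 0
  then show ?case unfolding computable_fun_def by (intro exI[of _ Zero]) (simp add: eval.Zero)
next
  case (Suc c)
  then show ?case by (rule computable_fun_Suc)
qed

text \<open>\<open>PrimRec\<close> recurses on its first argument, so
  \<open>map Proj [0..<n]\<close> hands the environment on unchanged behind the value of
  \<open>H\<close>. In the step, entries 0 and 1 are the counter and the previous value, in the
  order fixed by \<open>PrimRec_Suc\<close>.\<close>

lemma computable_fun_rec_nat:
  assumes F: "computable_fun n F"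
    and G: "computable_fun (Suc (Suc n)) (\<lambda>e. G (e 0) (e (Suc 0)) (\<lambda>i. e (Suc (Suc i))))"
    and H: "computable_fun n H"
  shows "computable_fun n (\<lambda>e. rec_nat (F e) (\<lambda>k r. G k r e) (H e))"
proof -
  obtain f where f: "\<And>e. eval f (map e [0..<n]) (F e)"
    using F unfolding computable_fun_def by blast
  obtain h where h: "\<And>e. eval h (map e [0..<n]) (H e)"
    using H unfolding computable_fun_def by blast
  obtain g where g: "\<And>e. eval g (map e [0..<Suc (Suc n)]) (G (e 0) (e (Suc 0)) (\<lambda>i. e (Suc (Suc i))))"
    using G unfolding computable_fun_def by blast
  have g': "eval g (k # r # map e [0..<n]) (G k r e)" for k r e
    using g[of "case_nat k (case_nat r e)"] by (simp add: map_upt_Suc del: upt_Suc)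
  have "eval (PrimRec f g) (m # map e [0..<n]) (rec_nat (F e) (\<lambda>k r. G k r e) m)" for m e
    by (induction m) (auto intro: eval.PrimRec_0 eval.PrimRec_Suc f g')
  moreover have "list_all2 (\<lambda>g. eval g (map e [0..<n])) (h # map Proj [0..<n]) (H e # map e [0..<n])" for e
    using eval.Proj[of _ "map e [0..<n]"] by (auto simp: list_all2_conv_all_nth h nth_Cons split: nat.split)
  ultimately have "eval (Comp (PrimRec f g) (h # map Proj [0..<n])) (map e [0..<n])
      (rec_nat (F e) (\<lambda>k r. G k r e) (H e))" for e
    by (blast intro: eval.Comp)
  then show ?thesis unfolding computable_fun_def by blast
qed

lemma computable_fun_If:
  assumes "computable_pred n P" "computable_fun n A" "computable_fun n B"
  shows "computable_fun n (\<lambda>e. if P e then A e else B e)"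
proof -
  obtain a b where a: "\<And>e. eval a (map e [0..<n]) (A e)" and b: "\<And>e. eval b (map e [0..<n]) (B e)"
    using assms(2,3) unfolding computable_fun_def by blast
  \<comment> \<open>Definition by cases as a recursion of length 0 or 1: entry 0 is the truth value,
    and a single step replaces the else value by the then value. Both branches are total, so
    evaluating both is harmless.\<close>
  have *: "computable_fun 3 (\<lambda>e. rec_nat (e 2) (\<lambda>_ _. e 1) (e 0))"
    by (rule computable_fun_rec_nat) (auto intro: computable_fun_var)
  have "computable_fun n ([\<lambda>e. if P e then 1 else 0, A, B] ! i)" if "i < 3" for i
  proof -
    have "i = 0 \<or> i = 1 \<or> i = 2" using that by auto
    then show ?thesis using assms by (auto simp: computable_pred_def)
  qed
  from computable_fun_subst[where G = "\<lambda>i. [\<lambda>e. if P e then 1 else 0, A, B] ! i", OF * this]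
  have "computable_fun n (\<lambda>e. rec_nat (B e) (\<lambda>_ _. A e) (if P e then 1 else 0))"
    by simp
  also have "(\<lambda>e. rec_nat (B e) (\<lambda>_ _. A e) (if P e then 1 else 0)) = (\<lambda>e. if P e then A e else B e)"
    by auto
  finally show ?thesis .
qed

lemma computable_fun_add:
  assumes "computable_fun n A" "computable_fun n B"
  shows "computable_fun n (\<lambda>e. A e + B e)"
proof (rule computable_fun_comp2[OF _ assms])
  have "computable_fun 2 (\<lambda>e. rec_nat (e 0) (\<lambda>_ r. Suc r) (e 1))"
    by (rule computable_fun_rec_nat) (auto intro!: computable_fun_var computable_fun_Suc)
  moreover have "rec_nat a (\<lambda>_ r. Suc r) b = a + b" for a b
    by (induction b) auto
  ultimately show "computable_fun 2 (\<lambda>e. e 0 + e 1)" by simp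
qed

lemma computable_fun_pred: "computable_fun n A \<Longrightarrow> computable_fun n (\<lambda>e. A e - 1)"
proof (rule computable_fun_comp1[where g = "\<lambda>a. a - 1"])
  have "computable_fun 1 (\<lambda>e. rec_nat 0 (\<lambda>k _. k) (e 0))"
    by (rule computable_fun_rec_nat) (auto intro!: computable_fun_var computable_fun_const)
  moreover have "rec_nat 0 (\<lambda>k _. k) b = b - 1" for b
    by (induction b) auto
  ultimately show "computable_fun 1 (\<lambda>e. e 0 - 1)" by simp
qed

lemma computable_fun_diff:
  assumes "computable_fun n A" "computable_fun n B"
  shows "computable_fun n (\<lambda>e. A e - B e)"
proof (rule computable_fun_comp2[OF _ assms])
  have "computable_fun 2 (\<lambda>e. rec_nat (e 0) (\<lambda>_ r. r - 1) (e 1))"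
    by (intro computable_fun_rec_nat computable_fun_pred computable_fun_var) auto
  moreover have "rec_nat a (\<lambda>_ r. r - 1) b = a - b" for a b
    by (induction b) auto
  ultimately show "computable_fun 2 (\<lambda>e. e 0 - e 1)" by simp
qed

lemma computable_fun_sum:
  assumes B: "computable_fun n B" and F: "computable_fun (Suc n) (\<lambda>e. F (e 0) (\<lambda>i. e (Suc i)))"
  shows "computable_fun n (\<lambda>e. \<Sum>i<B e. F i e)"
proof -
  have "computable_fun (Suc (Suc n)) (\<lambda>e. F (e 0) (\<lambda>i. e (Suc (Suc i))))"
    by (rule computable_fun_subst[OF F, of "Suc (Suc n)" "case_nat (\<lambda>e. e 0) (\<lambda>i e. e (Suc (Suc i)))", simplified])
      (auto intro!: computable_fun_var split: nat.split)
  then have "computable_fun n (\<lambda>e. rec_nat 0 (\<lambda>k r. r + F k e) (B e))"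
    by (intro computable_fun_rec_nat computable_fun_add computable_fun_var computable_fun_const B) auto
  moreover have "rec_nat 0 (\<lambda>k r. r + F k e) b = (\<Sum>i<b. F i e)" for b e
    by (induction b) auto
  ultimately show ?thesis by simp
qed

section \<open>Connectives, comparisons, bounded counting and search\<close>

lemma computable_pred_not:
  assumes "computable_pred n P"
  shows "computable_pred n (\<lambda>e. \<not> P e)"
proof -
  have "computable_fun n (\<lambda>e. if P e then 0 else 1)"
    by (intro computable_fun_If assms computable_fun_const)
  moreover have "(\<lambda>e. if P e then 0 else 1) = (\<lambda>e. if \<not> P e then 1 else (0::nat))"
    by auto
  ultimately show ?thesis by (simp only: computable_pred_def)
qed

lemma computable_pred_conj:
  assumes "computable_pred n P" "computable_pred n Q"
  shows "computable_pred n (\<lambda>e. P e \<and> Q e)"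
proof -
  have "computable_fun n (\<lambda>e. if P e then (if Q e then 1 else 0) else 0)"
    using assms by (intro computable_fun_If computable_fun_const)
  moreover have "(\<lambda>e. if P e then (if Q e then 1 else 0) else 0) = (\<lambda>e. if P e \<and> Q e then 1 else (0::nat))"
    by auto
  ultimately show ?thesis by (simp add: computable_pred_def)
qed

lemma computable_pred_disj:
  assumes "computable_pred n P" "computable_pred n Q"
  shows "computable_pred n (\<lambda>e. P e \<or> Q e)"
  using computable_pred_not[OF computable_pred_conj[OF computable_pred_not[OF assms(1)] computable_pred_not[OF assms(2)]]]
  by simp

text \<open>Truncated subtraction carries all comparisons: \<open>1 - A e\<close> is the
  characteristic function wanted here, and \<open>A e - B e = 0\<close> expresses
  \<open>A e \<le> B e\<close> below.\<close>

lemma computable_pred_zero: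
  assumes "computable_fun n A" shows "computable_pred n (\<lambda>e. A e = 0)"
proof -
  have "computable_fun n (\<lambda>e. 1 - A e)"
    by (intro computable_fun_diff computable_fun_const assms)
  moreover have "(\<lambda>e. 1 - A e) = (\<lambda>e. if A e = 0 then 1 else 0)" by auto
  ultimately show ?thesis by (simp add: computable_pred_def)
qed

lemma computable_pred_le:
  assumes "computable_fun n A" "computable_fun n B"
  shows "computable_pred n (\<lambda>e. A e \<le> B e)"
  using computable_pred_zero[OF computable_fun_diff[OF assms]] by simp

lemma computable_pred_less:
  assumes "computable_fun n A" "computable_fun n B"
  shows "computable_pred n (\<lambda>e. A e < B e)"
  using computable_pred_le[OF computable_fun_Suc[OF assms(1)] assms(2)] by (simp add: Suc_le_eq)

lemma computable_pred_eq:
  assumes "computable_fun n A" "computable_fun n B"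
  shows "computable_pred n (\<lambda>e. A e = B e)"
  using computable_pred_conj[OF computable_pred_le[OF assms] computable_pred_le[OF assms(2,1)]]
  by (simp add: eq_iff)

text \<open>A count is a sum of truth values. Bounded quantifiers are derived from it, and the
  counts themselves return later, for elements between two points of \<open>L\<close> and for
  candidates preceding a number.\<close>

lemma computable_fun_card:
  assumes "computable_fun n B" "computable_pred (Suc n) (\<lambda>e. P (e 0) (\<lambda>i. e (Suc i)))"
  shows "computable_fun n (\<lambda>e. card {i. i < B e \<and> P i e})"
proof -
  have "computable_fun n (\<lambda>e. \<Sum>i<B e. if P i e then 1 else 0)"
    using assms by (intro computable_fun_sum) (simp_all add: computable_pred_def)
  moreover have "(\<Sum>i<b. if P i e then 1 else 0) = card {i. i < b \<and> P i e}" for b e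
    by (simp add: card_eq_sum sum.If_cases Int_def del: sum_constant)
  ultimately show ?thesis by simp
qed

lemma computable_pred_bex:
  assumes "computable_fun n B" "computable_pred (Suc n) (\<lambda>e. P (e 0) (\<lambda>i. e (Suc i)))"
  shows "computable_pred n (\<lambda>e. \<exists>i<B e. P i e)"
proof -
  have "computable_pred n (\<lambda>e. \<not> card {i. i < B e \<and> P i e} = 0)"
    using assms by (intro computable_pred_not computable_pred_zero computable_fun_card)
  then show ?thesis by simp
qed

lemma computable_pred_ball:
  assumes "computable_fun n B" "computable_pred (Suc n) (\<lambda>e. P (e 0) (\<lambda>i. e (Suc i)))"
  shows "computable_pred n (\<lambda>e. \<forall>i<B e. P i e)"
  using computable_pred_not[OF computable_pred_bex[OF assms(1) computable_pred_not[OF assms(2)]]]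
  by simp

lemma computable_pred_rel:
  assumes "computable_rel R" "computable_fun n A" "computable_fun n B"
  shows "computable_pred n (\<lambda>e. (A e, B e) \<in> R)"
  unfolding computable_pred_def
proof (rule computable_fun_comp2[OF _ assms(2,3)])
  obtain f where "\<forall>x y. eval f [x, y] (if (x, y) \<in> R then 1 else 0)"
    using assms(1) unfolding computable_rel_def by blast
  then show "computable_fun 2 (\<lambda>e. if (e 0, e 1) \<in> R then 1 else 0)"
    unfolding computable_fun_def by (intro exI[of _ f]) (simp add: numeral_2_eq_2)
qed

lemmas computable_intros =
  computable_fun_const computable_fun_var computable_fun_Suc computable_fun_add computable_fun_diff
  computable_fun_If computable_fun_sum computable_fun_card
  computable_pred_not computable_pred_conj computable_pred_disj computable_pred_le computable_pred_less
  computable_pred_eq computable_pred_bex computable_pred_ball computable_pred_rel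

lemma computable_fun_Least:
  assumes P: "computable_pred (Suc n) (\<lambda>e. P (e 0) (\<lambda>i. e (Suc i)))" and ex: "\<And>e. \<exists>m. P m e"
  shows "computable_fun n (\<lambda>e. LEAST m. P m e)"
proof -
  \<comment> \<open>\<open>Mu\<close> looks for the value 0, so the program has to compute the
    negation of \<open>P\<close>. Its values are 0 and 1 only, which gives the positive values
    required below the minimum.\<close>
  obtain f where f: "\<And>e. eval f (map e [0..<Suc n]) (if \<not> P (e 0) (\<lambda>i. e (Suc i)) then 1 else 0)"
    using computable_pred_not[OF P] unfolding computable_pred_def computable_fun_def by blast
  have f': "eval f (m # map e [0..<n]) (if \<not> P m e then 1 else 0)" for m e
    using f[of "case_nat m e"] by (simp add: map_upt_Suc del: upt_Suc)
  have "eval (Mu f) (map e [0..<n]) (LEAST m. P m e)" for e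
  proof (rule eval.Mu)
    show "eval f ((LEAST m. P m e) # map e [0..<n]) 0"
      using f'[of "LEAST m. P m e" e] LeastI_ex[OF ex[of e]] by simp
    fix m assume "m < (LEAST m. P m e)"
    then show "\<exists>y>0. eval f (m # map e [0..<n]) y"
      using f'[of m e] not_less_Least[of m "\<lambda>m. P m e"] by (intro exI[of _ 1]) auto
  qed
  then show ?thesis unfolding computable_fun_def by blast
qed

section \<open>Semidecidable predicates\<close>

definition sigma1 :: "nat \<Rightarrow> ((nat \<Rightarrow> nat) \<Rightarrow> bool) \<Rightarrow> bool" where
  "sigma1 n P \<longleftrightarrow> (\<exists>T. computable_pred (Suc n) (\<lambda>e. T (e 0) (\<lambda>i. e (Suc i))) \<and>
     (\<forall>e. P e \<longleftrightarrow> (\<exists>s. T s e)))"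

lemma sigma1I:
  assumes "computable_pred (Suc n) (\<lambda>e. T (e 0) (\<lambda>i. e (Suc i)))" "\<And>e. P e \<longleftrightarrow> (\<exists>s. T s e)"
  shows "sigma1 n P"
  using assms unfolding sigma1_def by blast

lemma computable_pred_subst:
  assumes F: "computable_pred k P" and G: "\<And>i. i < k \<Longrightarrow> computable_fun n (G i)"
  shows "computable_pred n (\<lambda>e. P (\<lambda>i. G i e))"
  using computable_fun_subst[OF F[unfolded computable_pred_def] G] unfolding computable_pred_def by simp

text \<open>Searching all \<open>t \<le> s\<close> turns a witness into a stage: once confirmed, a
  fact stays confirmed. Finitely many confirmed facts then have a common stage.\<close>

lemma sigma1_monoE:
  assumes "sigma1 n P"
  obtains T where "computable_pred (Suc n) (\<lambda>e. T (e 0) (\<lambda>i. e (Suc i)))"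
    "\<And>s t e. T s e \<Longrightarrow> s \<le> t \<Longrightarrow> T t e" "\<And>e. P e \<longleftrightarrow> (\<exists>s. T s e)"
proof -
  obtain T where T: "computable_pred (Suc n) (\<lambda>e. T (e 0) (\<lambda>i. e (Suc i)))" "\<And>e. P e \<longleftrightarrow> (\<exists>s. T s e)"
    using assms unfolding sigma1_def by blast
  have "computable_pred (Suc (Suc n)) (\<lambda>e. T (e 0) (\<lambda>i. e (Suc (Suc i))))"
    by (rule computable_pred_subst[OF T(1), of "Suc (Suc n)" "case_nat (\<lambda>e. e 0) (\<lambda>i e. e (Suc (Suc i)))", simplified])
      (auto intro!: computable_fun_var split: nat.split)
  then have "computable_pred (Suc n) (\<lambda>e. \<exists>t<Suc (e 0). T t (\<lambda>i. e (Suc i)))"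
    by (intro computable_intros) auto
  then show ?thesis
  proof (rule that[of "\<lambda>s e. \<exists>t<Suc s. T t e"])
    show "\<exists>u<Suc t. T u e" if "\<exists>u<Suc s. T u e" "s \<le> t" for s t e
      using that by (meson Suc_le_mono less_le_trans)
    show "P e \<longleftrightarrow> (\<exists>s. \<exists>t<Suc s. T t e)" for e
      using T(2) by blast
  qed
qed

lemma sigma1_computable: "computable_pred n P \<Longrightarrow> sigma1 n P"
  by (rule sigma1I[where T = "\<lambda>_ e. P e"])
    (auto intro!: computable_pred_subst[where G = "\<lambda>i e. e (Suc i)"] computable_fun_var)

lemma sigma1_subst:
  assumes P: "sigma1 k P" and G: "\<And>i. i < k \<Longrightarrow> computable_fun n (G i)"
  shows "sigma1 n (\<lambda>e. P (\<lambda>i. G i e))"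
proof -
  obtain T where T: "computable_pred (Suc k) (\<lambda>e. T (e 0) (\<lambda>i. e (Suc i)))" "\<And>e. P e \<longleftrightarrow> (\<exists>s. T s e)"
    using P unfolding sigma1_def by blast
  have "computable_fun (Suc n) (\<lambda>e. G i (\<lambda>i. e (Suc i)))" if "i < k" for i
    by (rule computable_fun_subst[OF G[OF that], of "Suc n" "\<lambda>i e. e (Suc i)"])
      (simp add: computable_fun_var)
  then have "computable_pred (Suc n) (\<lambda>e. T (e 0) (\<lambda>i. G i (\<lambda>i. e (Suc i))))"
    by (intro computable_pred_subst[OF T(1), of "Suc n" "case_nat (\<lambda>e. e 0) (\<lambda>i e. G i (\<lambda>i. e (Suc i)))", simplified])
      (auto intro!: computable_fun_var split: nat.split)
  then show ?thesis
    by (rule sigma1I) (use T(2) in simp)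
qed

lemma sigma1_conj:
  assumes "sigma1 n P" "sigma1 n Q"
  shows "sigma1 n (\<lambda>e. P e \<and> Q e)"
proof -
  obtain S where S: "computable_pred (Suc n) (\<lambda>e. S (e 0) (\<lambda>i. e (Suc i)))"
    "\<And>s t e. S s e \<Longrightarrow> s \<le> t \<Longrightarrow> S t e" "\<And>e. P e \<longleftrightarrow> (\<exists>s. S s e)"
    by (rule sigma1_monoE[OF assms(1)]) (rule that)
  obtain T where T: "computable_pred (Suc n) (\<lambda>e. T (e 0) (\<lambda>i. e (Suc i)))"
    "\<And>s t e. T s e \<Longrightarrow> s \<le> t \<Longrightarrow> T t e" "\<And>e. Q e \<longleftrightarrow> (\<exists>s. T s e)"
    by (rule sigma1_monoE[OF assms(2)]) (rule that)
  show ?thesis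
  proof (rule sigma1I[where T = "\<lambda>s e. S s e \<and> T s e"])
    show "computable_pred (Suc n) (\<lambda>e. S (e 0) (\<lambda>i. e (Suc i)) \<and> T (e 0) (\<lambda>i. e (Suc i)))"
      by (intro computable_intros S T)
    show "P e \<and> Q e \<longleftrightarrow> (\<exists>s. S s e \<and> T s e)" for e
      using S(2,3) T(2,3) by (meson nat_le_linear)
  qed
qed

text \<open>The stage doubles as the bound on \<open>y\<close>, which merges two unbounded searches
  into one. By monotonicity the stage \<open>Suc (y + s)\<close> is beyond both \<open>y\<close> and
  its witness \<open>s\<close>.\<close>

lemma sigma1_ex:
  assumes "sigma1 (Suc n) (\<lambda>e. P (e 0) (\<lambda>i. e (Suc i)))"
  shows "sigma1 n (\<lambda>e. \<exists>y. P y e)"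
proof -
  obtain T where T: "computable_pred (Suc (Suc n)) (\<lambda>e. T (e 0) (\<lambda>i. e (Suc i)))"
    "\<And>s t e. T s e \<Longrightarrow> s \<le> t \<Longrightarrow> T t e" "\<And>e. P (e 0) (\<lambda>i. e (Suc i)) \<longleftrightarrow> (\<exists>s. T s e)"
    by (rule sigma1_monoE[OF assms]) (rule that)
  have *: "P y e \<longleftrightarrow> (\<exists>s. T s (case_nat y e))" for y e
    using T(3)[of "case_nat y e"] by simp
  have "computable_pred (Suc (Suc n)) (\<lambda>e. T (e (Suc 0)) (case_nat (e 0) (\<lambda>i. e (Suc (Suc i)))))"
  proof -
    have "computable_pred (Suc (Suc n)) (\<lambda>e. T (e (Suc 0)) (\<lambda>i. case_nat (\<lambda>e. e 0) (\<lambda>i e. e (Suc (Suc i))) i e))"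
      by (rule computable_pred_subst[OF T(1), of "Suc (Suc n)" "case_nat (\<lambda>e. e (Suc 0)) (case_nat (\<lambda>e. e 0) (\<lambda>i e. e (Suc (Suc i))))", simplified])
       (auto intro!: computable_fun_var split: nat.split)
    moreover have "(\<lambda>i. case_nat (\<lambda>e. e 0) (\<lambda>i e. e (Suc (Suc i))) i e) = case_nat (e 0) (\<lambda>i. e (Suc (Suc i)))" for e :: "nat \<Rightarrow> nat"
      by (auto split: nat.split)
    ultimately show ?thesis by simp
  qed
  then have "computable_pred (Suc n) (\<lambda>e. \<exists>y<e 0. T (e 0) (case_nat y (\<lambda>i. e (Suc i))))"
    by (intro computable_intros) auto
  then show ?thesis
  proof (rule sigma1I)
    show "(\<exists>y. P y e) \<longleftrightarrow> (\<exists>s. \<exists>y<s. T s (case_nat y e))" for e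
    proof
      assume "\<exists>y. P y e"
      then obtain y s where "T s (case_nat y e)" using * by blast
      then have "T (Suc (y + s)) (case_nat y e)" by (rule T(2)) simp
      then show "\<exists>s. \<exists>y<s. T s (case_nat y e)" by (intro exI[of _ "Suc (y + s)"] exI[of _ y]) simp
    qed (use * in blast)
  qed
qed

text \<open>Look for the first stage \<open>t\<close> at which some \<open>y < t\<close> is
  confirmed, then return the least \<open>y\<close> confirmed at that stage. The first search may
  diverge and determines the domain; the second is total.\<close>

lemma partial_computable_uniformization:
  assumes P: "sigma1 2 (\<lambda>e. P (e 0) (e 1))"
  obtains \<phi> where "partial_computable \<phi>" "dom \<phi> = {x. \<exists>y. P x y}" "\<And>x y. \<phi> x = Some y \<Longrightarrow> P x y"
proof -
  obtain T where T: "computable_pred (Suc 2) (\<lambda>e. T (e 0) (\<lambda>i. e (Suc i)))"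
    "\<And>s t e. T s e \<Longrightarrow> s \<le> t \<Longrightarrow> T t e" "\<And>e. P (e 0) (e 1) \<longleftrightarrow> (\<exists>s. T s e)"
    by (rule sigma1_monoE[OF P]) (rule that)
  define R where "R s x y = T s (case_nat x (\<lambda>_. y))" for s x y
  have PR: "P x y \<longleftrightarrow> (\<exists>s. R s x y)" for x y
    using T(3)[of "case_nat x (\<lambda>_. y)"] by (simp add: R_def)
  have Rmono: "R s x y \<Longrightarrow> s \<le> t \<Longrightarrow> R t x y" for s t x y
    unfolding R_def by (rule T(2))
  have R: "computable_pred n (\<lambda>e. R (A e) (B e) (D e))"
    if "computable_fun n A" "computable_fun n B" "computable_fun n D" for n A B D
  proof -
    have "computable_fun n (case_nat A (case_nat B (\<lambda>_. D)) i)" for i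
      using that by (auto split: nat.split)
    from computable_pred_subst[where G = "case_nat A (case_nat B (\<lambda>_. D))", OF T(1) this]
    have "computable_pred n (\<lambda>e. T (A e) (\<lambda>i. case_nat B (\<lambda>_. D) i e))" by simp
    moreover have "(\<lambda>i. case_nat B (\<lambda>_. D) i e) = case_nat (B e) (\<lambda>_. D e)" for e
      by (auto split: nat.split)
    ultimately show ?thesis by (simp add: R_def)
  qed
  define Q where "Q t x \<longleftrightarrow> (\<exists>y<t. R t x y)" for t x
  have Q: "computable_pred n (\<lambda>e. Q (A e) (B e))" if "computable_fun n A" "computable_fun n B" for n A B
  proof -
    have "computable_pred 2 (\<lambda>e. Q (e 0) (e 1))"
      unfolding Q_def by (intro computable_intros R) auto
    then show ?thesis
      unfolding computable_pred_def
      by (rule computable_fun_comp2[where g = "\<lambda>a b. if Q a b then 1 else 0", OF _ that])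
  qed
  obtain f where f: "\<And>e. eval f (map e [0..<2]) (if \<not> Q (e 0) (e 1) then 1 else 0)"
    using computable_pred_not[OF Q[OF computable_fun_var[of 0 2] computable_fun_var[of 1 2]]]
    unfolding computable_pred_def computable_fun_def by auto
  have f: "eval f [t, x] (if Q t x then 0 else 1)" for t x
    using f[of "case_nat t (\<lambda>_. x)"] by (cases "Q t x") (simp_all add: numeral_2_eq_2)
  have f0: "eval f [t, x] 0 \<longleftrightarrow> Q t x" for t x
    using f[of t x] eval_deterministic[of f "[t, x]" _ 0] by (auto split: if_splits)
  have f1: "(\<exists>y>0. eval f [t, x] y) \<longleftrightarrow> \<not> Q t x" for t x
    using f[of t x] eval_deterministic[of f "[t, x]" _ 0] by (auto split: if_splits)
  have mu: "eval (Mu f) [x] t \<longleftrightarrow> Q t x \<and> (\<forall>s<t. \<not> Q s x)" for t x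
    using eval.Mu[of f t "[x]"] f0 f1 by (auto elim!: eval_MuE)
  \<comment> \<open>The alternative \<open>y = t\<close> only makes the minimization total. Where
    \<open>Q t x\<close> holds, some confirmed \<open>y\<close> lies below \<open>t\<close>, so the
    default is never returned.\<close>
  define h where "h t x = (LEAST y. R t x y \<or> y = t)" for t x
  have "computable_fun 2 (\<lambda>e. h (e 0) (e 1))"
    unfolding h_def by (intro computable_fun_Least computable_intros R) auto
  then obtain g where g: "\<And>e. eval g (map e [0..<2]) (h (e 0) (e 1))"
    unfolding computable_fun_def by blast
  have g: "eval g [t, x] (h t x)" for t x
    using g[of "case_nat t (\<lambda>_. x)"] by (simp add: numeral_2_eq_2)
  define \<phi> where "\<phi> x = (if \<exists>t. Q t x then Some (h (LEAST t. Q t x) x) else None)" for x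
  have least: "Q t x \<and> (\<forall>s<t. \<not> Q s x) \<longleftrightarrow> (\<exists>t. Q t x) \<and> t = (LEAST t. Q t x)" for t x
  proof
    assume t: "Q t x \<and> (\<forall>s<t. \<not> Q s x)"
    then have "(LEAST t. Q t x) = t" by (intro Least_equality) (auto simp: not_less[symmetric])
    then show "(\<exists>t. Q t x) \<and> t = (LEAST t. Q t x)" using t by blast
  next
    assume "(\<exists>t. Q t x) \<and> t = (LEAST t. Q t x)"
    then show "Q t x \<and> (\<forall>s<t. \<not> Q s x)"
      using LeastI_ex[of "\<lambda>t. Q t x"] not_less_Least[of _ "\<lambda>t. Q t x"] by blast
  qed
  have "eval (Comp g [Mu f, Proj 0]) [x] y \<longleftrightarrow> \<phi> x = Some y" for x y
  proof
    assume "eval (Comp g [Mu f, Proj 0]) [x] y"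
    then obtain t where "eval (Mu f) [x] t" "eval g [t, x] y"
      by (auto elim!: eval_CompE eval_ProjE simp: list_all2_Cons1)
    then have "\<exists>t. Q t x" "t = (LEAST t. Q t x)" "y = h t x"
      using eval_deterministic[OF _ g[of t x]] mu[of x t] least[of t x] by blast+
    then show "\<phi> x = Some y" unfolding \<phi>_def by simp
  next
    assume "\<phi> x = Some y"
    then have y: "\<exists>t. Q t x" "y = h (LEAST t. Q t x) x" by (auto simp: \<phi>_def split: if_splits)
    then have "eval (Mu f) [x] (LEAST t. Q t x)" using mu least by blast
    then show "eval (Comp g [Mu f, Proj 0]) [x] y"
      unfolding y(2) using eval.Proj[of 0 "[x]"] by (intro eval.Comp[OF _ g]) auto
  qed
  then have "partial_computable \<phi>" unfolding partial_computable_def by blast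
  moreover have "dom \<phi> = {x. \<exists>y. P x y}"
  proof -
    have "(\<exists>t. Q t x) \<longleftrightarrow> (\<exists>y. P x y)" for x
    proof
      assume "\<exists>y. P x y"
      then obtain y s where "R s x y" using PR by blast
      then have "R (Suc (y + s)) x y" by (rule Rmono) simp
      then show "\<exists>t. Q t x" unfolding Q_def by (intro exI[of _ "Suc (y + s)"] exI[of _ y]) simp
    qed (use PR in \<open>auto simp: Q_def\<close>)
    then show ?thesis by (auto simp: \<phi>_def dom_def)
  qed
  moreover have "P x y" if "\<phi> x = Some y" for x y
  proof -
    define t where "t = (LEAST t. Q t x)"
    have ex: "\<exists>t. Q t x" and t: "y = h t x"
      using that by (auto simp: \<phi>_def t_def split: if_splits)
    from LeastI_ex[OF ex] have "Q t x" unfolding t_def .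
    then obtain z where z: "z < t" "R t x z" unfolding Q_def by blast
    have "R t x y \<or> y = t" unfolding t h_def by (rule LeastI[of _ t]) simp
    moreover have "y \<le> z" unfolding t h_def by (rule Least_le) (simp add: z)
    ultimately have "R t x y" using z by auto
    then show ?thesis using PR by blast
  qed
  ultimately show ?thesis by (rule that)
qed

lemma ce_set_sigma1:
  assumes "sigma1 1 (\<lambda>e. P (e 0))"
  shows "ce_set {x. P x}"
proof -
  have "sigma1 2 (\<lambda>e. P (e 0))"
    using sigma1_subst[OF assms, of 2 "\<lambda>i e. e 0"] by (simp add: computable_fun_var)
  then have "sigma1 2 (\<lambda>e. (\<lambda>x _. P x) (e 0) (e 1))" by simp
  then obtain \<phi> where "partial_computable \<phi>" "dom \<phi> = {x. \<exists>y::nat. P x}"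
    by (rule partial_computable_uniformization[where P = "\<lambda>x _. P x"])
  then show ?thesis unfolding ce_set_def by (intro exI[of _ \<phi>]) simp
qed

section \<open>Stagewise approximation of partial computable functions\<close>

text \<open>\<open>F\<close> is a function of infinite environments, but a program computing it
  receives only the list of the first \<open>n\<close> entries, and by determinism that list fixes
  the value.\<close>

lemma computable_fun_cong:
  assumes "computable_fun n F" "\<And>i. i < n \<Longrightarrow> d i = e i"
  shows "F d = F e"
proof -
  obtain f where f: "\<And>e. eval f (map e [0..<n]) (F e)"
    using assms(1) unfolding computable_fun_def by blast
  have "map d [0..<n] = map e [0..<n]" using assms(2) by simp
  then show ?thesis using eval_deterministic f[of d] f[of e] by metis
qed

text \<open>Here \<open>m\<close> is a fixed number and the \<open>P i\<close> need not be
  computable uniformly in \<open>i\<close>, as is the case for the arguments of a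
  \<open>Comp\<close> program. In \<open>computable_pred_ball\<close> the bound varies and
  \<open>i\<close> is an input.\<close>

lemma computable_pred_all_fixed:
  fixes m :: nat
  shows "(\<And>i. i < m \<Longrightarrow> computable_pred n (P i)) \<Longrightarrow> computable_pred n (\<lambda>e. \<forall>i<m. P i e)"
proof (induction m)
  case 0
  have "computable_pred n (\<lambda>e. 0 \<le> (0::nat))" by (intro computable_intros)
  then show ?case by simp
next
  case (Suc m)
  then have "computable_pred n (\<lambda>e. (\<forall>i<m. P i e) \<and> P m e)"
    by (intro computable_pred_conj) auto
  then show ?case by (simp add: All_less_Suc conj_commute)
qed

text \<open>The value \<open>0\<close> means that the computation has not stopped by stage \<open>s\<close>, and \<open>Suc y\<close> that it
  has stopped with result \<open>y\<close>.\<close>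

definition approximates :: "nat \<Rightarrow> (nat \<Rightarrow> (nat \<Rightarrow> nat) \<Rightarrow> nat) \<Rightarrow> recf \<Rightarrow> bool" where
  "approximates n S f \<longleftrightarrow> computable_fun (Suc n) (\<lambda>e. S (e 0) (\<lambda>i. e (Suc i))) \<and>
     (\<forall>s t e y. S s e = Suc y \<longrightarrow> s \<le> t \<longrightarrow> S t e = Suc y) \<and>
     (\<forall>e y. eval f (map e [0..<n]) y \<longleftrightarrow> (\<exists>s. S s e = Suc y))"

lemma approximatesD:
  assumes "approximates n S f"
  shows "computable_fun (Suc n) (\<lambda>e. S (e 0) (\<lambda>i. e (Suc i)))"
    "\<And>s t e y. S s e = Suc y \<Longrightarrow> s \<le> t \<Longrightarrow> S t e = Suc y"
    "\<And>e y. eval f (map e [0..<n]) y \<longleftrightarrow> (\<exists>s. S s e = Suc y)"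
    "\<And>e y. eval f (map e [0..<n]) y \<longleftrightarrow> (\<forall>\<^sub>F s in sequentially. S s e = Suc y)"
proof -
  show 1: "computable_fun (Suc n) (\<lambda>e. S (e 0) (\<lambda>i. e (Suc i)))"
    "\<And>s t e y. S s e = Suc y \<Longrightarrow> s \<le> t \<Longrightarrow> S t e = Suc y"
    "\<And>e y. eval f (map e [0..<n]) y \<longleftrightarrow> (\<exists>s. S s e = Suc y)"
    using assms unfolding approximates_def by blast+
  show "eval f (map e [0..<n]) y \<longleftrightarrow> (\<forall>\<^sub>F s in sequentially. S s e = Suc y)" for e y
    unfolding 1(3) eventually_sequentially using 1(2) by blast
qed

lemma approximates_cong:
  assumes "approximates n S f" "\<And>i. i < n \<Longrightarrow> d i = e i"
  shows "S s d = S s e"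
  using computable_fun_cong[OF approximatesD(1)[OF assms(1)], of "case_nat s d" "case_nat s e"] assms(2)
  by (auto split: nat.splits)

text \<open>For programs whose outcome is known at stage 0: the basic functions, and programs run on
  a list of the wrong length, which keep the value 0 forever.\<close>

lemma approximates_constant:
  assumes "computable_fun (Suc n) (\<lambda>e. A (\<lambda>i. e (Suc i)))"
    and "\<And>e y. eval f (map e [0..<n]) y \<longleftrightarrow> A e = Suc y"
  shows "approximates n (\<lambda>_. A) f"
  using assms unfolding approximates_def by simp

text \<open>Wait until all arguments have stopped by stage \<open>s\<close>, strip the encoding with
  \<open>- 1\<close>, and run \<open>f\<close> up to the same stage. For the converse, finitely many
  halting computations have a common stage, which is why the eventual form in
  \<open>approximatesD\<close> is used.\<close>

lemma approximates_Comp: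
  assumes f: "approximates (length gs) F f"
    and g: "\<And>i. i < length gs \<Longrightarrow> approximates n (G i) (gs ! i)"
  shows "approximates n (\<lambda>s e. if \<forall>i<length gs. G i s e \<noteq> 0 then F s (\<lambda>i. G i s e - 1) else 0) (Comp f gs)"
    (is "approximates n ?S _")
proof -
  let ?m = "length gs"
  note Fc = approximatesD(1)[OF f] and Fm = approximatesD(2)[OF f]
  note Gc = approximatesD(1)[OF g] and Gm = approximatesD(2)[OF g]
  have "computable_fun (Suc n) (case_nat (\<lambda>e. e 0) (\<lambda>i e. G i (e 0) (\<lambda>i. e (Suc i)) - 1) i)" if "i < Suc ?m" for i
    using that by (auto split: nat.split intro!: computable_fun_var computable_fun_pred[unfolded One_nat_def] Gc)
  from computable_fun_subst[where G = "case_nat (\<lambda>e. e 0) (\<lambda>i e. G i (e 0) (\<lambda>i. e (Suc i)) - 1)", OF Fc this]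
  have "computable_fun (Suc n) (\<lambda>e. F (e 0) (\<lambda>i. G i (e 0) (\<lambda>i. e (Suc i)) - 1))" by simp
  then have "computable_fun (Suc n) (\<lambda>e. ?S (e 0) (\<lambda>i. e (Suc i)))"
    by (intro computable_fun_If computable_pred_all_fixed computable_pred_not computable_pred_eq
        computable_fun_const Gc)
  moreover have "?S t e = Suc y" if "?S s e = Suc y" "s \<le> t" for s t e y
  proof -
    have ne: "\<forall>i<?m. G i s e \<noteq> 0" and F: "F s (\<lambda>i. G i s e - 1) = Suc y"
      using that(1) by (auto split: if_splits)
    have eq: "G i t e = G i s e" if "i < ?m" for i
      using Gm[OF that _ \<open>s \<le> t\<close>, of e "G i s e - 1"] ne that by auto
    \<comment> \<open>The two environments agree only below \<open>?m\<close>; nothing is known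
      about \<open>G i\<close> for larger \<open>i\<close>. The restriction to the entries actually
      read is therefore essential.\<close>
    have "F t (\<lambda>i. G i t e - 1) = F t (\<lambda>i. G i s e - 1)"
      by (rule approximates_cong[OF f]) (simp add: eq)
    then show ?thesis using Fm[OF F \<open>s \<le> t\<close>] ne eq by auto
  qed
  moreover have "eval (Comp f gs) (map e [0..<n]) y \<longleftrightarrow> (\<exists>s. ?S s e = Suc y)" for e y
  proof
    assume "eval (Comp f gs) (map e [0..<n]) y"
    then obtain ys where ys: "list_all2 (\<lambda>g. eval g (map e [0..<n])) gs ys" "eval f ys y"
      by (rule eval_CompE)
    have "eval f (map (\<lambda>i. ys ! i) [0..<?m]) y"
      using ys(2) list_all2_lengthD[OF ys(1)] by (simp add: map_nth)
    then have "\<forall>\<^sub>F s in sequentially. F s (\<lambda>i. ys ! i) = Suc y"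
      using approximatesD(4)[OF f] by blast
    moreover have "\<forall>\<^sub>F s in sequentially. \<forall>i\<in>{..<?m}. G i s e = Suc (ys ! i)"
      using list_all2_nthD[OF ys(1)] approximatesD(4)[OF g] by (intro eventually_ball_finite) auto
    ultimately have "\<forall>\<^sub>F s in sequentially. F s (\<lambda>i. ys ! i) = Suc y \<and> (\<forall>i\<in>{..<?m}. G i s e = Suc (ys ! i))"
      by eventually_elim simp
    then obtain s where s: "F s (\<lambda>i. ys ! i) = Suc y" "\<And>i. i < ?m \<Longrightarrow> G i s e = Suc (ys ! i)"
      by (auto simp: eventually_sequentially)
    have "F s (\<lambda>i. G i s e - 1) = F s (\<lambda>i. ys ! i)"
      by (rule approximates_cong[OF f]) (simp add: s)
    then show "\<exists>s. ?S s e = Suc y" using s by (intro exI[of _ s]) auto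
  next
    assume "\<exists>s. ?S s e = Suc y"
    then obtain s where s: "\<forall>i<?m. G i s e \<noteq> 0" "F s (\<lambda>i. G i s e - 1) = Suc y"
      by (auto split: if_splits)
    have "list_all2 (\<lambda>g. eval g (map e [0..<n])) gs (map (\<lambda>i. G i s e - 1) [0..<?m])"
    proof (rule list_all2_all_nthI)
      fix i assume "i < ?m"
      then have "G i s e = Suc (G i s e - 1)" using s(1) by simp
      then have "eval (gs ! i) (map e [0..<n]) (G i s e - 1)"
        using approximatesD(3)[OF g[OF \<open>i < ?m\<close>]] by blast
      then show "eval (gs ! i) (map e [0..<n]) (map (\<lambda>i. G i s e - 1) [0..<?m] ! i)"
        using \<open>i < ?m\<close> by simp
    qed simp
    moreover have "eval f (map (\<lambda>i. G i s e - 1) [0..<?m]) y"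
      using approximatesD(3)[OF f] s(2) by blast
    ultimately show "eval (Comp f gs) (map e [0..<n]) y" by (rule eval.Comp)
  qed
  ultimately show ?thesis unfolding approximates_def by blast
qed

text \<open>The recursion carries encoded values, so a step that has not stopped yields 0 and blocks
  all later steps. One stage \<open>s\<close> serves for every call; enlarging it preserves the
  calls that have already stopped.\<close>

lemma approximates_PrimRec:
  assumes f: "approximates n F f" and g: "approximates (Suc (Suc n)) G g"
  shows "approximates (Suc n) (\<lambda>s e. rec_nat (F s (\<lambda>i. e (Suc i)))
    (\<lambda>k r. if r = 0 then 0 else G s (case_nat k (case_nat (r - 1) (\<lambda>i. e (Suc i))))) (e 0)) (PrimRec f g)"
    (is "approximates _ ?S _")
proof -
  define A where "A s k e = rec_nat (F s e) (\<lambda>k r. if r = 0 then 0 else G s (case_nat k (case_nat (r - 1) e))) k"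
    for s k e
  have A0: "A s 0 e = F s e" and AS: "A s (Suc k) e = Suc y \<longleftrightarrow>
      (\<exists>r. A s k e = Suc r \<and> G s (case_nat k (case_nat r e)) = Suc y)" for s k e y
    by (auto simp: A_def gr0_conv_Suc)
  have S: "?S s e = A s (e 0) (\<lambda>i. e (Suc i))" for s e
    by (simp add: A_def)
  have Am: "A t k e = Suc y" if "A s k e = Suc y" "s \<le> t" for s t k e y
    using that(1)
  proof (induction k arbitrary: y)
    case 0
    then show ?case using approximatesD(2)[OF f] that(2) unfolding A0 by blast
  next
    case (Suc k)
    from Suc.prems obtain r where "A s k e = Suc r" "G s (case_nat k (case_nat r e)) = Suc y"
      unfolding AS by blast
    then have "A t k e = Suc r" "G t (case_nat k (case_nat r e)) = Suc y"
      using Suc.IH approximatesD(2)[OF g _ that(2)] by blast+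
    then show ?case unfolding AS by blast
  qed
  have ev: "eval (PrimRec f g) (k # map e [0..<n]) y \<longleftrightarrow> (\<exists>s. A s k e = Suc y)" for k e y
  proof (induction k arbitrary: y)
    case 0
    have "eval (PrimRec f g) (0 # map e [0..<n]) y \<longleftrightarrow> eval f (map e [0..<n]) y"
      by (auto elim: eval_PrimRec_0E intro: eval.PrimRec_0)
    then show ?case by (simp add: A0 approximatesD(3)[OF f])
  next
    case (Suc k)
    have *: "eval g (k # r # map e [0..<n]) y \<longleftrightarrow> (\<exists>s. G s (case_nat k (case_nat r e)) = Suc y)" for r
      using approximatesD(3)[OF g, of "case_nat k (case_nat r e)"] by (simp add: map_upt_Suc del: upt_Suc)
    have "eval (PrimRec f g) (Suc k # map e [0..<n]) y \<longleftrightarrow>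
        (\<exists>r. eval (PrimRec f g) (k # map e [0..<n]) r \<and> eval g (k # r # map e [0..<n]) y)"
      by (auto elim: eval_PrimRec_SucE intro: eval.PrimRec_Suc)
    also have "\<dots> \<longleftrightarrow> (\<exists>r s t. A s k e = Suc r \<and> G t (case_nat k (case_nat r e)) = Suc y)"
      by (auto simp: Suc.IH *)
    also have "\<dots> \<longleftrightarrow> (\<exists>s r. A s k e = Suc r \<and> G s (case_nat k (case_nat r e)) = Suc y)"
    proof
      assume "\<exists>r s t. A s k e = Suc r \<and> G t (case_nat k (case_nat r e)) = Suc y"
      then obtain r s t where "A s k e = Suc r" "G t (case_nat k (case_nat r e)) = Suc y" by blast
      then have "A (max s t) k e = Suc r" "G (max s t) (case_nat k (case_nat r e)) = Suc y"
        using Am approximatesD(2)[OF g] by (meson max.cobounded1 max.cobounded2)+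
      then show "\<exists>s r. A s k e = Suc r \<and> G s (case_nat k (case_nat r e)) = Suc y" by blast
    qed blast
    finally show ?case by (simp add: AS)
  qed
  have "computable_fun (Suc (Suc n)) (\<lambda>e. F (e 0) (\<lambda>i. e (Suc (Suc i))))"
  proof -
    have "computable_fun (Suc (Suc n)) (case_nat (\<lambda>e. e 0) (\<lambda>i e. e (Suc (Suc i))) i)" if "i < Suc n" for i
      using that by (auto split: nat.split intro!: computable_fun_var)
    from computable_fun_subst[where G = "case_nat (\<lambda>e. e 0) (\<lambda>i e. e (Suc (Suc i)))", OF approximatesD(1)[OF f] this]
    show ?thesis by simp
  qed
  moreover have "computable_fun (Suc (Suc (Suc (Suc n))))
      (\<lambda>e. G (e (Suc (Suc 0))) (case_nat (e 0) (case_nat (e (Suc 0) - 1) (\<lambda>i. e (Suc (Suc (Suc (Suc i))))))))"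
  proof -
    define H :: "nat \<Rightarrow> (nat \<Rightarrow> nat) \<Rightarrow> nat" where "H = case_nat (\<lambda>e. e (Suc (Suc 0))) (case_nat (\<lambda>e. e 0)
      (case_nat (\<lambda>e. e (Suc 0) - 1) (\<lambda>i e. e (Suc (Suc (Suc (Suc i)))))))"
    have "computable_fun (Suc (Suc (Suc (Suc n)))) (H i)" if "i < Suc (Suc (Suc n))" for i
      using that unfolding H_def
      by (auto split: nat.split intro!: computable_fun_var computable_fun_pred[unfolded One_nat_def])
    from computable_fun_subst[where G = H, OF approximatesD(1)[OF g] this]
    have "computable_fun (Suc (Suc (Suc (Suc n)))) (\<lambda>e. G (H 0 e) (\<lambda>i. H (Suc i) e))" .
    moreover have "(\<lambda>i. H (Suc i) e) =
        case_nat (e 0) (case_nat (e (Suc 0) - 1) (\<lambda>i. e (Suc (Suc (Suc (Suc i))))))" for e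
      by (auto simp: H_def split: nat.split)
    moreover have "H 0 e = e (Suc (Suc 0))" for e by (simp add: H_def)
    ultimately show ?thesis by simp
  qed
  ultimately have "computable_fun (Suc (Suc n)) (\<lambda>e. ?S (e 0) (\<lambda>i. e (Suc i)))"
    by (intro computable_fun_rec_nat computable_fun_If computable_pred_eq computable_fun_const
        computable_fun_var) auto
  moreover have "?S t e = Suc y" if "?S s e = Suc y" "s \<le> t" for s t e y
    using that Am unfolding S by blast
  moreover have "eval (PrimRec f g) (map e [0..<Suc n]) y \<longleftrightarrow> (\<exists>s. ?S s e = Suc y)" for e y
    unfolding S using ev[of "e 0" "\<lambda>i. e (Suc i)" y] by (simp only: map_upt_Suc)
  ultimately show ?thesis unfolding approximates_def by blast
qed

text \<open>In encoded values, 1 means stopped with result 0 and at least 2 means stopped with a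
  positive result. At most one \<open>m\<close> passes the test at a given stage, so the sum has at
  most one nonzero term and returns exactly the encoded minimizer.\<close>

lemma approximates_Mu:
  assumes f: "approximates (Suc n) F f"
  shows "approximates n (\<lambda>s e. \<Sum>m<s. if F s (case_nat m e) = 1 \<and> (\<forall>j<m. 2 \<le> F s (case_nat j e)) then Suc m else 0) (Mu f)"
    (is "approximates _ ?S _")
proof -
  define Z where "Z s m e \<longleftrightarrow> F s (case_nat m e) = 1 \<and> (\<forall>j<m. 2 \<le> F s (case_nat j e))" for s m e
  have Z_unique: "m = k" if "Z s m e" "Z s k e" for s m k e
    using that unfolding Z_def by (cases m k rule: linorder_cases) fastforce+
  have S: "?S s e = Suc m \<longleftrightarrow> m < s \<and> Z s m e" for s e m
  proof (cases "\<exists>k<s. Z s k e")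
    case True
    then obtain k where k: "k < s" "Z s k e" by blast
    have "?S s e = (\<Sum>m<s. if m = k then Suc k else 0)"
    proof (rule sum.cong)
      fix m
      have "Z s m e \<longleftrightarrow> m = k" using Z_unique[OF _ k(2)] k(2) by blast
      then show "(if F s (case_nat m e) = 1 \<and> (\<forall>j<m. 2 \<le> F s (case_nat j e)) then Suc m else 0) =
          (if m = k then Suc k else 0)"
        unfolding Z_def[symmetric] by simp
    qed simp
    then have "?S s e = Suc k" using k(1) by simp
    then show ?thesis using k Z_unique[OF _ k(2), of m] by (metis nat.inject)
  next
    case False
    then have "?S s e = 0" unfolding Z_def[symmetric] by (intro sum.neutral) auto
    then show ?thesis using False by auto
  qed
  note Fm = approximatesD(2)[OF f]
  have Fm2: "F t e \<ge> 2" if "F s e \<ge> 2" "s \<le> t" for s t e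
    using Fm[of s e "F s e - 1" t] that by auto
  have Zm: "Z t m e" if "Z s m e" "s \<le> t" for s t m e
    using that Fm[of s _ 0 t] Fm2[of s _ t] unfolding Z_def by auto
  have evf: "eval f (m # map e [0..<n]) y \<longleftrightarrow> (\<forall>\<^sub>F s in sequentially. F s (case_nat m e) = Suc y)" for m e y
    using approximatesD(4)[OF f, of "case_nat m e"] by (simp add: map_upt_Suc del: upt_Suc)
  have evf': "eval f (m # map e [0..<n]) y \<longleftrightarrow> (\<exists>s. F s (case_nat m e) = Suc y)" for m e y
    using approximatesD(3)[OF f, of "case_nat m e"] by (simp add: map_upt_Suc del: upt_Suc)
  have "eval (Mu f) (map e [0..<n]) m \<longleftrightarrow> (\<exists>s. ?S s e = Suc m)" for e m
  proof
    assume "eval (Mu f) (map e [0..<n]) m"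
    then have "eval f (m # map e [0..<n]) 0" "\<And>j. j < m \<Longrightarrow> \<exists>y>0. eval f (j # map e [0..<n]) y"
      using eval_MuE by blast+
    then have at_m: "\<forall>\<^sub>F s in sequentially. F s (case_nat m e) = 1"
      and pos: "\<And>j. j < m \<Longrightarrow> \<exists>y>0. \<forall>\<^sub>F s in sequentially. F s (case_nat j e) = Suc y"
      using evf by auto
    have "\<forall>\<^sub>F s in sequentially. \<forall>j\<in>{..<m}. 2 \<le> F s (case_nat j e)"
    proof (rule eventually_ball_finite)
      show "\<forall>j\<in>{..<m}. \<forall>\<^sub>F s in sequentially. 2 \<le> F s (case_nat j e)"
      proof
        fix j assume "j \<in> {..<m}"
        then obtain y where "y > 0" "\<forall>\<^sub>F s in sequentially. F s (case_nat j e) = Suc y"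
          using pos by blast
        then show "\<forall>\<^sub>F s in sequentially. 2 \<le> F s (case_nat j e)"
          by (auto elim: eventually_mono)
      qed
    qed simp
    moreover have "\<forall>\<^sub>F s in sequentially. m < s" by (rule eventually_gt_at_top)
    ultimately have "\<forall>\<^sub>F s in sequentially. m < s \<and> Z s m e"
      using at_m by eventually_elim (auto simp: Z_def)
    then show "\<exists>s. ?S s e = Suc m"
      unfolding S by (auto simp: eventually_sequentially)
  next
    assume "\<exists>s. ?S s e = Suc m"
    then obtain s where s: "F s (case_nat m e) = Suc 0" "\<And>j. j < m \<Longrightarrow> 2 \<le> F s (case_nat j e)"
      unfolding S Z_def by auto
    show "eval (Mu f) (map e [0..<n]) m"
    proof (rule eval.Mu)
      show "eval f (m # map e [0..<n]) 0" using s(1) evf' by blast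
      show "\<exists>y>0. eval f (j # map e [0..<n]) y" if "j < m" for j
        using s(2)[OF that] evf' by (intro exI[of _ "F s (case_nat j e) - 1"]) auto
    qed
  qed
  moreover have "?S t e = Suc m" if "?S s e = Suc m" "s \<le> t" for s t e m
    using that Zm unfolding S by auto
  moreover have "computable_fun (Suc n) (\<lambda>e. ?S (e 0) (\<lambda>i. e (Suc i)))"
  proof -
    have F: "computable_fun k (\<lambda>e. F (A e) (case_nat (B e) (\<lambda>i. D i e)))"
      if "computable_fun k A" "computable_fun k B" "\<And>i. i < n \<Longrightarrow> computable_fun k (D i)" for k A B D
    proof -
      have "computable_fun k (case_nat A (case_nat B D) i)" if "i < Suc (Suc n)" for i
        using that \<open>computable_fun k A\<close> \<open>computable_fun k B\<close> \<open>\<And>i. i < n \<Longrightarrow> computable_fun k (D i)\<close>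
        by (auto split: nat.split)
      from computable_fun_subst[where G = "case_nat A (case_nat B D)", OF approximatesD(1)[OF f] this]
      have "computable_fun k (\<lambda>e. F (A e) (\<lambda>i. case_nat B D i e))" by simp
      moreover have "(\<lambda>i. case_nat B D i e) = case_nat (B e) (\<lambda>i. D i e)" for e
        by (auto split: nat.split)
      ultimately show ?thesis by simp
    qed
    show ?thesis
      by (intro computable_fun_sum computable_fun_If computable_pred_conj computable_pred_eq
          computable_pred_ball computable_pred_le F computable_fun_Suc computable_fun_const computable_fun_var) auto
  qed
  ultimately show ?thesis unfolding approximates_def by blast
qed

text \<open>A normal form for each fixed program. The arity is generalised in the induction because
  subprograms run on lists of other lengths.\<close>

lemma ex_approximates: "\<exists>S. approximates n S f"
proof (induction f arbitrary: n)
  case Zero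
  have "approximates n (\<lambda>_ _. 1) Zero"
    by (rule approximates_constant) (auto intro: computable_fun_const eval.Zero elim: eval_ZeroE)
  then show ?case by blast
next
  case Succ
  have "approximates n (\<lambda>_ e. if n = 1 then Suc (Suc (e 0)) else 0) Succ"
  proof (rule approximates_constant)
    show "computable_fun (Suc n) (\<lambda>e. if n = 1 then Suc (Suc (e (Suc 0))) else 0)"
      by (cases "n = 1") (auto intro!: computable_intros)
    show "eval Succ (map e [0..<n]) y \<longleftrightarrow> (if n = 1 then Suc (Suc (e 0)) else 0) = Suc y" for e y
      by (cases "n = 1") (auto elim!: eval_SuccE intro: eval.Succ simp: map_eq_Cons_conv upt_eq_Cons_conv)
  qed
  then show ?case by blast
next
  case (Proj i)
  have "approximates n (\<lambda>_ e. if i < n then Suc (e i) else 0) (Proj i)"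
  proof (rule approximates_constant)
    show "computable_fun (Suc n) (\<lambda>e. if i < n then Suc (e (Suc i)) else 0)"
      by (cases "i < n") (auto intro!: computable_intros)
    show "eval (Proj i) (map e [0..<n]) y \<longleftrightarrow> (if i < n then Suc (e i) else 0) = Suc y" for e y
      using eval.Proj[of i "map e [0..<n]"] by (auto elim!: eval_ProjE)
  qed
  then show ?case by blast
next
  case (Comp f gs)
  obtain F where "approximates (length gs) F f" using Comp.IH(1) by blast
  moreover have "\<forall>i. \<exists>G. i < length gs \<longrightarrow> approximates n G (gs ! i)"
    using Comp.IH(2) nth_mem by blast
  then obtain G where "\<And>i. i < length gs \<Longrightarrow> approximates n (G i) (gs ! i)" by metis
  ultimately show ?case by (blast intro: approximates_Comp)
next
  case (PrimRec f g)
  show ?case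
  proof (cases n)
    case 0
    \<comment> \<open>On the empty list \<open>PrimRec\<close> has no argument to recurse on, so
      neither of its rules applies.\<close>
    have "approximates n (\<lambda>_ _. 0) (PrimRec f g)"
      by (rule approximates_constant) (auto intro: computable_fun_const elim: eval.cases simp: 0)
    then show ?thesis by blast
  next
    case (Suc m)
    then show ?thesis using PrimRec.IH approximates_PrimRec by blast
  qed
next
  case (Mu f)
  then show ?case using approximates_Mu by blast
qed

text \<open>The bridge from programs to semidecidable predicates; the stage approximations enter the
  rest of the development through this lemma.\<close>

lemma sigma1_graph:
  assumes "partial_computable \<phi>" "computable_fun n A" "computable_fun n B"
  shows "sigma1 n (\<lambda>e. \<phi> (A e) = Some (B e))"
proof -
  obtain f where f: "\<And>x y. eval f [x] y \<longleftrightarrow> \<phi> x = Some y"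
    using assms(1) unfolding partial_computable_def by blast
  obtain S where S: "approximates 1 S f" using ex_approximates by blast
  have *: "\<phi> (e 0) = Some y \<longleftrightarrow> (\<exists>s. S s e = Suc y)" for e y
    using approximatesD(3)[OF S, of e y] f[of "e 0" y] by simp
  have "sigma1 2 (\<lambda>e. \<phi> (e 0) = Some (e 1))"
  proof (rule sigma1I)
    have "computable_fun (Suc 2) (case_nat (\<lambda>e. e 0) (\<lambda>i e. e (Suc 0)) i)" for i
      by (auto split: nat.split intro!: computable_fun_var)
    from computable_fun_subst[where G = "case_nat (\<lambda>e. e 0) (\<lambda>i e. e (Suc 0))", OF approximatesD(1)[OF S] this]
    have "computable_fun (Suc 2) (\<lambda>e. S (e 0) (\<lambda>i. e (Suc 0)))" by simp
    then show "computable_pred (Suc 2) (\<lambda>e. S (e 0) (\<lambda>i. e (Suc 0)) = Suc (e (Suc 1)))"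
      by (intro computable_intros) auto
    show "\<phi> (e 0) = Some (e 1) \<longleftrightarrow> (\<exists>s. S s (\<lambda>_. e 0) = Suc (e 1))" for e
      using *[of "\<lambda>_. e 0"] by simp
  qed
  moreover have "computable_fun n ((case_nat A (\<lambda>_. B)) i)" for i
    using assms by (auto split: nat.split)
  ultimately show ?thesis
    using sigma1_subst[where G = "case_nat A (\<lambda>_. B)"] by fastforce
qed

section \<open>Saturation along a co-c.e. cohesive set\<close>

text \<open>Almost all elements of \<open>C\<close>, as a filter. For cohesive \<open>C\<close> it
  is proper and decides every c.e. set, so it behaves like an ultrafilter on semidecidable
  predicates, and the power like an ultrapower.\<close>

definition along :: "nat set \<Rightarrow> nat filter" where
  "along C = inf cofinite (principal C)"

lemma eventually_along: "eventually P (along C) \<longleftrightarrow> finite {n \<in> C. \<not> P n}"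
  by (simp add: along_def eventually_inf_principal eventually_cofinite)

lemma almost_subset_along: "C \<subseteq>* S \<longleftrightarrow> (\<forall>\<^sub>F n in along C. n \<in> S)"
  by (simp add: almost_subset_def eventually_along set_diff_eq)

lemma along_ge: "\<forall>\<^sub>F n in along C. N \<le> n"
proof -
  have "{n \<in> C. \<not> N \<le> n} \<subseteq> {..<N}" by auto
  then show ?thesis unfolding eventually_along using finite_subset by blast
qed

lemma along_neq_bot: "cohesive C \<Longrightarrow> along C \<noteq> bot"
  unfolding trivial_limit_def eventually_along cohesive_def by simp

lemma cohesive_dichotomy:
  assumes "cohesive C" "sigma1 1 (\<lambda>e. P (e 0))"
  shows "(\<forall>\<^sub>F n in along C. P n) \<or> (\<forall>\<^sub>F n in along C. \<not> P n)"
  using ce_set_sigma1[OF assms(2)] assms(1)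
  unfolding cohesive_def eventually_along by (auto simp: set_diff_eq Int_def)

text \<open>The natural attempt is to let \<open>\<theta> n\<close> be some \<open>l\<close> with \<open>R k n l\<close> for a \<open>k\<close> that grows with \<open>n\<close>,
  but no computable growth rate need be available. Instead \<open>k\<close> is accepted for \<open>n\<close> at a stage where \<open>n\<close>
  is among the first \<open>k + 1\<close> numbers that currently look like elements of \<open>C\<close> having a solution
  for \<open>k\<close>. Each \<open>k\<close> is then accepted for finitely many elements of \<open>C\<close> only, while infinitely many
  elements of \<open>C\<close> receive a value, hence almost all do by cohesiveness.\<close>

lemma cohesive_saturation:
  assumes C: "cohesive C" "co_ce_set C"
    and R: "sigma1 3 (\<lambda>e. R (e 0) (e 1) (e 2))"
    and anti: "\<And>k n l. R (Suc k) n l \<Longrightarrow> R k n l"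
    and ex: "\<And>k. \<forall>\<^sub>F n in along C. \<exists>l. R k n l"
  obtains \<theta> where "partial_computable \<theta>" "\<And>k. \<forall>\<^sub>F n in along C. \<exists>l. \<theta> n = Some l \<and> R k n l"
    "\<And>n l. \<theta> n = Some l \<Longrightarrow> \<exists>k. R k n l"
proof -
  have "sigma1 1 (\<lambda>e. e 0 \<notin> C)"
  proof -
    obtain \<phi> where \<phi>: "partial_computable \<phi>" "- C = dom \<phi>"
      using C(2) unfolding co_ce_set_def ce_set_def by blast
    have "x \<notin> C \<longleftrightarrow> (\<exists>y. \<phi> x = Some y)" for x using \<phi>(2) by auto
    then show ?thesis
      by (simp, intro sigma1_ex sigma1_graph \<phi> computable_fun_var) auto
  qed
  then obtain D' where D': "computable_pred (Suc 1) (\<lambda>e. D' (e 0) (\<lambda>i. e (Suc i)))"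
    "\<And>s t e. D' s e \<Longrightarrow> s \<le> t \<Longrightarrow> D' t e" "\<And>e. e 0 \<notin> C \<longleftrightarrow> (\<exists>s. D' s e)"
    by (rule sigma1_monoE) (rule that)
  define D where "D s x = D' s (\<lambda>_. x)" for s x
  have D_mono: "D s x \<Longrightarrow> s \<le> t \<Longrightarrow> D t x" for s t x
    unfolding D_def by (rule D'(2))
  have D_iff: "x \<notin> C \<longleftrightarrow> (\<exists>s. D s x)" for x
    using D'(3)[of "\<lambda>_. x"] by (simp add: D_def)
  have D: "computable_pred m (\<lambda>e. D (A e) (B e))"
    if "computable_fun m A" "computable_fun m B" for m A B
  proof -
    have "computable_fun m (case_nat A (\<lambda>_. B) i)" for i
      using that by (auto split: nat.split)
    from computable_pred_subst[where G = "case_nat A (\<lambda>_. B)", OF D'(1) this]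
    show ?thesis by (simp add: D_def)
  qed
  obtain T' where T': "computable_pred (Suc 3) (\<lambda>e. T' (e 0) (\<lambda>i. e (Suc i)))"
    "\<And>s t e. T' s e \<Longrightarrow> s \<le> t \<Longrightarrow> T' t e" "\<And>e. R (e 0) (e 1) (e 2) \<longleftrightarrow> (\<exists>s. T' s e)"
    by (rule sigma1_monoE[OF R]) (rule that)
  define T where "T s k n l = T' s (case_nat k (case_nat n (\<lambda>_. l)))" for s k n l
  have T_mono: "T s k n l \<Longrightarrow> s \<le> t \<Longrightarrow> T t k n l" for s t k n l
    unfolding T_def by (rule T'(2))
  have T_iff: "R k n l \<longleftrightarrow> (\<exists>s. T s k n l)" for k n l
    using T'(3)[of "case_nat k (case_nat n (\<lambda>_. l))"] by (simp add: T_def numeral_2_eq_2)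
  have T: "computable_pred m (\<lambda>e. T (A e) (B e) (F e) (G e))"
    if "computable_fun m A" "computable_fun m B" "computable_fun m F" "computable_fun m G" for m A B F G
  proof -
    have "computable_fun m (case_nat A (case_nat B (case_nat F (\<lambda>_. G))) i)" for i
      using that by (auto split: nat.split)
    from computable_pred_subst[where G = "case_nat A (case_nat B (case_nat F (\<lambda>_. G)))", OF T'(1) this]
    have "computable_pred m (\<lambda>e. T' (A e) (\<lambda>i. case_nat B (case_nat F (\<lambda>_. G)) i e))" by simp
    moreover have "(\<lambda>i. case_nat B (case_nat F (\<lambda>_. G)) i e) = case_nat (B e) (case_nat (F e) (\<lambda>_. G e))" for e
      by (auto split: nat.split)
    ultimately show ?thesis by (simp add: T_def)
  qed
  define X where "X s k n \<longleftrightarrow> (\<exists>l<s. T s k n l)" for s k n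
  have X_mono: "X s k n \<Longrightarrow> s \<le> t \<Longrightarrow> X t k n" for s t k n
    unfolding X_def using T_mono by (meson less_le_trans)
  have X_iff: "(\<exists>l. R k n l) \<longleftrightarrow> (\<exists>s. X s k n)" for k n
  proof
    assume "\<exists>l. R k n l"
    then obtain l s where "T s k n l" using T_iff by blast
    then have "T (Suc (s + l)) k n l" by (rule T_mono) simp
    then show "\<exists>s. X s k n" unfolding X_def by (intro exI[of _ "Suc (s + l)"] exI[of _ l]) simp
  qed (use T_iff X_def in blast)
  \<comment> \<open>The candidates below \<open>n\<close> at stage \<open>s\<close>. This set is not
    monotone in \<open>s\<close>: numbers leave when they are enumerated into the complement of
    \<open>C\<close> and enter when a solution for \<open>k\<close> is found.\<close>
  define before where "before s k n = {m. m < n \<and> \<not> D s m \<and> X s k m}" for s k n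
  \<comment> \<open>The demand \<open>n \<le> s\<close> prevents acceptance at an early stage, where
    few solutions are known and the count is too small. It makes large \<open>n\<close> face only
    late stages.\<close>
  define Q where "Q n l \<longleftrightarrow> (\<exists>s k. n \<le> s \<and> T s k n l \<and> card (before s k n) \<le> k)" for n l
  have "sigma1 2 (\<lambda>e. Q (e 0) (e 1))"
    unfolding Q_def before_def X_def
    by (intro sigma1_ex sigma1_computable computable_intros D T) auto
  then obtain \<theta> where \<theta>: "partial_computable \<theta>" "dom \<theta> = {n. \<exists>l. Q n l}"
      "\<And>n l. \<theta> n = Some l \<Longrightarrow> Q n l"
    by (rule partial_computable_uniformization) (rule that)
  define W where "W k = {n \<in> C. \<exists>l. R k n l}" for k
  have W: "infinite (W k)" for k
  proof
    assume "finite (W k)"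
    moreover have "finite {n \<in> C. \<not> (\<exists>l. R k n l)}" using ex unfolding eventually_along .
    moreover have "C = W k \<union> {n \<in> C. \<not> (\<exists>l. R k n l)}" by (auto simp: W_def)
    ultimately have "finite C" by (metis finite_UnI)
    then show False using C(1) unfolding cohesive_def by blast
  qed
  have "infinite (C \<inter> dom \<theta>)"
    unfolding infinite_nat_iff_unbounded_le
  proof
    fix k
    \<comment> \<open>This \<open>n\<close> has exactly \<open>k\<close> predecessors in
      \<open>W k\<close>, so it passes the test for \<open>k\<close> once all false candidates below
      it have left. As \<open>k \<le> n\<close>, varying \<open>k\<close> gives unboundedly many
      accepted elements of \<open>C\<close>.\<close>
    define n where "n = enumerate (W k) k"
    have "n \<in> W k" unfolding n_def by (rule enumerate_in_set[OF W])
    then obtain l s0 where n: "n \<in> C" "T s0 k n l" unfolding W_def using T_iff by auto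
    have "k \<le> n" unfolding n_def by (rule le_enumerate[OF W])
    have "\<forall>m\<in>{m. m < n \<and> m \<notin> C}. \<forall>\<^sub>F s in sequentially. D s m"
      using D_iff D_mono by (auto simp: eventually_sequentially) blast
    then have "\<forall>\<^sub>F s in sequentially. \<forall>m\<in>{m. m < n \<and> m \<notin> C}. D s m"
      by (intro eventually_ball_finite) auto
    then obtain s1 where s1: "\<And>s m. s1 \<le> s \<Longrightarrow> m < n \<Longrightarrow> m \<notin> C \<Longrightarrow> D s m"
      unfolding eventually_sequentially by blast
    \<comment> \<open>The summands secure in turn \<open>n \<le> s\<close>, the confirmation of the
      solution \<open>l\<close>, and the departure of every number below \<open>n\<close> outside
      \<open>C\<close>.\<close>
    define s where "s = n + s0 + s1"
    have "before s k n \<subseteq> enumerate (W k) ` {..<k}"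
    proof
      fix m assume "m \<in> before s k n"
      then have m: "m < n" "\<not> D s m" "X s k m" unfolding before_def by auto
      then have "m \<in> W k" unfolding W_def using s1[of s m] X_iff by (auto simp: s_def)
      then obtain i where "m = enumerate (W k) i" using enumerate_Ex[OF W] by metis
      with m(1) show "m \<in> enumerate (W k) ` {..<k}"
        unfolding n_def using strict_mono_less[OF strict_mono_enumerate[OF W]] by auto
    qed
    then have "card (before s k n) \<le> k"
      by (metis card_lessThan surj_card_le finite_lessThan)
    moreover have "T s k n l" using n(2) by (rule T_mono) (simp add: s_def)
    ultimately have "Q n l" unfolding Q_def by (intro exI[of _ s] exI[of _ k]) (simp add: s_def)
    then show "\<exists>n\<ge>k. n \<in> C \<inter> dom \<theta>" using n(1) \<open>k \<le> n\<close> \<theta>(2) by blast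
  qed
  moreover have "ce_set (dom \<theta>)" using \<theta>(1) unfolding ce_set_def by blast
  ultimately have "finite (C - dom \<theta>)" using C(1) unfolding cohesive_def by blast
  then have total: "\<forall>\<^sub>F n in along C. n \<in> dom \<theta>"
    by (simp add: eventually_along set_diff_eq)
  \<comment> \<open>Fix \<open>k + 1\<close> elements of \<open>W k\<close>. They never leave, and
    from some stage on their solutions are known; so for \<open>n\<close> beyond them and beyond
    that stage, the count exceeds \<open>k\<close> at every admissible stage and \<open>k\<close> is
    refused.\<close>
  have bound: "\<forall>\<^sub>F n in along C. \<forall>s\<ge>n. k < card (before s k n)" for k
  proof -
    obtain F where F: "finite F" "card F = Suc k" "F \<subseteq> W k"
      using infinite_arbitrarily_large[OF W] by blast
    have "\<forall>m\<in>F. \<forall>\<^sub>F s in sequentially. X s k m"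
    proof
      fix m assume "m \<in> F"
      then obtain s where "X s k m" using F(3) X_iff unfolding W_def by blast
      then show "\<forall>\<^sub>F s in sequentially. X s k m"
        unfolding eventually_sequentially using X_mono by blast
    qed
    then have "\<forall>\<^sub>F s in sequentially. \<forall>m\<in>F. X s k m"
      using F(1) by (intro eventually_ball_finite)
    then obtain S where S: "\<And>s m. S \<le> s \<Longrightarrow> m \<in> F \<Longrightarrow> X s k m"
      unfolding eventually_sequentially by blast
    show ?thesis using along_ge[where N = "S + Suc (Max F)"]
    proof eventually_elim
      case (elim n)
      show ?case
      proof (intro allI impI)
        fix s assume "n \<le> s"
        have "F \<subseteq> before s k n"
        proof
          fix m assume m: "m \<in> F"
          then have "m < n" using Max_ge[OF F(1) m] elim by simp
          moreover have "\<not> D s m" using D_iff m F(3) unfolding W_def by blast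
          moreover have "X s k m" using S[OF _ m] elim \<open>n \<le> s\<close> by simp
          ultimately show "m \<in> before s k n" unfolding before_def by simp
        qed
        then have "card F \<le> card (before s k n)"
          by (intro card_mono) (auto simp: before_def)
        then show "k < card (before s k n)" using F(2) by simp
      qed
    qed
  qed
  have R_anti: "R k n l" if "R j n l" "k \<le> j" for k j n l
    using that(2,1) by (induction rule: dec_induct) (auto intro: anti)
  have "\<forall>\<^sub>F n in along C. \<exists>l. \<theta> n = Some l \<and> R k n l" for k
  proof -
    \<comment> \<open>Once every \<open>j < k\<close> is refused, the index accepted with the value
      of \<open>\<theta>\<close> is at least \<open>k\<close>, and a solution for it is also one for
      \<open>k\<close>.\<close>
    have "\<forall>\<^sub>F n in along C. \<forall>j\<in>{..<k}. \<forall>s\<ge>n. j < card (before s j n)"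
      using bound by (intro eventually_ball_finite) auto
    with total show ?thesis
    proof eventually_elim
      case (elim n)
      then obtain l where l: "\<theta> n = Some l" by blast
      then obtain s j where s: "n \<le> s" "T s j n l" "card (before s j n) \<le> j"
        using \<theta>(3) unfolding Q_def by blast
      then have "k \<le> j" using elim(2) by (meson lessThan_iff not_less)
      then have "R k n l" using R_anti T_iff s(2) by blast
      then show ?case using l by blast
    qed
  qed
  \<comment> \<open>Stated for all \<open>n\<close>, also outside \<open>C\<close>: membership in
    \<open>power_funs\<close> restricts the whole range of \<open>\<theta>\<close>, not only its
    values along \<open>C\<close>.\<close>
  moreover have "\<exists>k. R k n l" if "\<theta> n = Some l" for n l
    using \<theta>(3)[OF that] T_iff unfolding Q_def by blast
  ultimately show ?thesis by (rule that[OF \<theta>(1)])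
qed

section \<open>Countable dense linear orders without endpoints\<close>

definition unbounded_dense :: "'a lorder \<Rightarrow> bool" where
  "unbounded_dense M \<longleftrightarrow> elems M \<noteq> {} \<and>
     (\<forall>x\<in>elems M. \<exists>y\<in>elems M. (x, y) \<in> less_rel M) \<and>
     (\<forall>x\<in>elems M. \<exists>y\<in>elems M. (y, x) \<in> less_rel M) \<and>
     (\<forall>x\<in>elems M. \<forall>y\<in>elems M. (x, y) \<in> less_rel M \<longrightarrow>
        (\<exists>z\<in>elems M. (x, z) \<in> less_rel M \<and> (z, y) \<in> less_rel M))"

lemma linear_lorderD:
  assumes "linear_lorder M"
  shows "\<And>x y. (x, y) \<in> less_rel M \<Longrightarrow> x \<in> elems M \<and> y \<in> elems M"
    and "\<And>x y z. (x, y) \<in> less_rel M \<Longrightarrow> (y, z) \<in> less_rel M \<Longrightarrow> (x, z) \<in> less_rel M"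
    and "\<And>x. (x, x) \<notin> less_rel M"
    and "\<And>x y. x \<in> elems M \<Longrightarrow> y \<in> elems M \<Longrightarrow> (x, y) \<in> less_rel M \<or> x = y \<or> (y, x) \<in> less_rel M"
  using assms unfolding linear_lorder_def strict_linear_order_on_def total_on_def
  by (blast dest: transD irreflD)+

lemma linear_lorderI:
  assumes "\<And>x y. (x, y) \<in> less_rel M \<Longrightarrow> x \<in> elems M \<and> y \<in> elems M"
    and "\<And>x y z. (x, y) \<in> less_rel M \<Longrightarrow> (y, z) \<in> less_rel M \<Longrightarrow> (x, z) \<in> less_rel M"
    and "\<And>x. (x, x) \<notin> less_rel M"
    and "\<And>x y. x \<in> elems M \<Longrightarrow> y \<in> elems M \<Longrightarrow> x \<noteq> y \<Longrightarrow> (x, y) \<in> less_rel M \<or> (y, x) \<in> less_rel M"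
  shows "linear_lorder M"
  unfolding linear_lorder_def strict_linear_order_on_def
proof (intro conjI)
  show "less_rel M \<subseteq> elems M \<times> elems M" using assms(1) by auto
  show "trans (less_rel M)" using assms(2) by (rule transI)
  show "irrefl (less_rel M)" using assms(3) by (rule irreflI)
  show "total_on (elems M) (less_rel M)" using assms(4) by (rule total_onI)
qed

lemma finite_greatest:
  assumes "linear_lorder M" "finite A" "A \<noteq> {}" "A \<subseteq> elems M"
  shows "\<exists>x\<in>A. \<forall>y\<in>A. y = x \<or> (y, x) \<in> less_rel M"
  using assms(2-)
proof (induction rule: finite_ne_induct)
  case (insert a A)
  then obtain x where x: "x \<in> A" "\<forall>y\<in>A. y = x \<or> (y, x) \<in> less_rel M" by auto
  have "(a, x) \<in> less_rel M \<or> a = x \<or> (x, a) \<in> less_rel M"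
    using linear_lorderD(4)[OF assms(1)] x(1) insert.prems by blast
  then consider "(a, x) \<in> less_rel M \<or> a = x" | "(x, a) \<in> less_rel M" by blast
  then show ?case
  proof cases
    case 1
    then show ?thesis using x by (intro bexI[of _ x]) auto
  next
    case 2
    then have "\<forall>y\<in>A. (y, a) \<in> less_rel M" using x(2) linear_lorderD(2)[OF assms(1)] by metis
    then show ?thesis by (intro bexI[of _ a]) auto
  qed
qed simp

lemma finite_least:
  assumes "linear_lorder M" "finite A" "A \<noteq> {}" "A \<subseteq> elems M"
  shows "\<exists>x\<in>A. \<forall>y\<in>A. y = x \<or> (x, y) \<in> less_rel M"
  using assms(2-)
proof (induction rule: finite_ne_induct)
  case (insert a A)
  then obtain x where x: "x \<in> A" "\<forall>y\<in>A. y = x \<or> (x, y) \<in> less_rel M" by auto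
  have "(a, x) \<in> less_rel M \<or> a = x \<or> (x, a) \<in> less_rel M"
    using linear_lorderD(4)[OF assms(1)] x(1) insert.prems by blast
  then consider "(x, a) \<in> less_rel M \<or> a = x" | "(a, x) \<in> less_rel M" by blast
  then show ?case
  proof cases
    case 1
    then show ?thesis using x by (intro bexI[of _ x]) auto
  next
    case 2
    then have "\<forall>y\<in>A. (a, y) \<in> less_rel M" using x(2) linear_lorderD(2)[OF assms(1)] by metis
    then show ?thesis by (intro bexI[of _ a]) auto
  qed
qed simp

text \<open>Only the greatest point of \<open>A\<close> and the least point of \<open>B\<close>
  matter. If one side is empty, the absence of an endpoint replaces density.\<close>

lemma unbounded_dense_between:
  assumes M: "linear_lorder M" "unbounded_dense M"
    and fin: "finite A" "finite B" and sub: "A \<subseteq> elems M" "B \<subseteq> elems M"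
    and less: "\<And>x y. x \<in> A \<Longrightarrow> y \<in> B \<Longrightarrow> (x, y) \<in> less_rel M"
  shows "\<exists>z\<in>elems M. (\<forall>x\<in>A. (x, z) \<in> less_rel M) \<and> (\<forall>y\<in>B. (z, y) \<in> less_rel M)"
proof -
  note tr = linear_lorderD(2)[OF M(1)]
  consider "A = {}" "B = {}" | "A = {}" "B \<noteq> {}" | "A \<noteq> {}" "B = {}" | "A \<noteq> {}" "B \<noteq> {}" by blast
  then show ?thesis
  proof cases
    case 1
    then show ?thesis using M(2) unfolding unbounded_dense_def by auto
  next
    case 2
    obtain b where b: "b \<in> B" "\<forall>y\<in>B. y = b \<or> (b, y) \<in> less_rel M"
      using finite_least[OF M(1) fin(2) 2(2) sub(2)] by blast
    obtain z where "z \<in> elems M" "(z, b) \<in> less_rel M"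
      using M(2) b(1) sub(2) unfolding unbounded_dense_def by blast
    then show ?thesis using b tr 2 by (metis empty_iff)
  next
    case 3
    obtain a where a: "a \<in> A" "\<forall>y\<in>A. y = a \<or> (y, a) \<in> less_rel M"
      using finite_greatest[OF M(1) fin(1) 3(1) sub(1)] by blast
    obtain z where "z \<in> elems M" "(a, z) \<in> less_rel M"
      using M(2) a(1) sub(1) unfolding unbounded_dense_def by blast
    then show ?thesis using a tr 3 by (metis empty_iff)
  next
    case 4
    obtain a where a: "a \<in> A" "\<forall>y\<in>A. y = a \<or> (y, a) \<in> less_rel M"
      using finite_greatest[OF M(1) fin(1) 4(1) sub(1)] by blast
    obtain b where b: "b \<in> B" "\<forall>y\<in>B. y = b \<or> (b, y) \<in> less_rel M"
      using finite_least[OF M(1) fin(2) 4(2) sub(2)] by blast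
    obtain z where "z \<in> elems M" "(a, z) \<in> less_rel M" "(z, b) \<in> less_rel M"
      using M(2) a(1) b(1) sub less unfolding unbounded_dense_def by blast
    then show ?thesis using a b tr by (metis empty_iff)
  qed
qed

section \<open>Cantor's back-and-forth argument\<close>

definition partial_iso :: "'a lorder \<Rightarrow> 'b lorder \<Rightarrow> ('a \<times> 'b) set \<Rightarrow> bool" where
  "partial_iso M N p \<longleftrightarrow> finite p \<and> p \<subseteq> elems M \<times> elems N \<and>
     (\<forall>(a, b)\<in>p. \<forall>(c, d)\<in>p. (a = c \<longleftrightarrow> b = d) \<and> ((a, c) \<in> less_rel M \<longleftrightarrow> (b, d) \<in> less_rel N))"

lemma partial_isoD:
  assumes "partial_iso M N p"
  shows "finite p" "p \<subseteq> elems M \<times> elems N"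
    "\<And>a b c d. (a, b) \<in> p \<Longrightarrow> (c, d) \<in> p \<Longrightarrow> a = c \<longleftrightarrow> b = d"
    "\<And>a b c d. (a, b) \<in> p \<Longrightarrow> (c, d) \<in> p \<Longrightarrow> (a, c) \<in> less_rel M \<longleftrightarrow> (b, d) \<in> less_rel N"
  using assms unfolding partial_iso_def by (simp, simp, fast, fast)

lemma partial_isoI:
  assumes "finite p" "p \<subseteq> elems M \<times> elems N"
    "\<And>a b c d. (a, b) \<in> p \<Longrightarrow> (c, d) \<in> p \<Longrightarrow> a = c \<longleftrightarrow> b = d"
    "\<And>a b c d. (a, b) \<in> p \<Longrightarrow> (c, d) \<in> p \<Longrightarrow> (a, c) \<in> less_rel M \<longleftrightarrow> (b, d) \<in> less_rel N"
  shows "partial_iso M N p"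
  unfolding partial_iso_def
  by (intro conjI assms(1,2) ballI case_prodI2) (use assms(3,4) in metis)+

lemma partial_iso_converse:
  assumes "partial_iso M N p" shows "partial_iso N M (p\<inverse>)"
proof (rule partial_isoI)
  show "finite (p\<inverse>)" using partial_isoD(1)[OF assms] by simp
  show "p\<inverse> \<subseteq> elems N \<times> elems M" using partial_isoD(2)[OF assms] by blast
qed (use partial_isoD(3,4)[OF assms] in \<open>metis converse_iff\<close>)+

text \<open>The image of \<open>a\<close> has to fill the finite cut in \<open>N\<close> that
  corresponds to the position of \<open>a\<close> relative to \<open>Domain p\<close>. Density is
  used on the side where the new point is sought, so the back step is this lemma applied to the
  converse relation.\<close>

lemma partial_iso_extend:
  assumes M: "linear_lorder M" and N: "linear_lorder N" "unbounded_dense N"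
    and p: "partial_iso M N p" and a: "a \<in> elems M"
  shows "\<exists>q. partial_iso M N q \<and> p \<subseteq> q \<and> a \<in> Domain q"
proof (cases "a \<in> Domain p")
  case True
  then show ?thesis using p by blast
next
  case False
  define A where "A = {d. \<exists>c. (c, d) \<in> p \<and> (c, a) \<in> less_rel M}"
  define B where "B = {d. \<exists>c. (c, d) \<in> p \<and> (a, c) \<in> less_rel M}"
  have "A \<subseteq> Range p" "B \<subseteq> Range p" unfolding A_def B_def by blast+
  then have fin: "finite A" "finite B"
    using finite_Range[OF partial_isoD(1)[OF p]] by (auto intro: finite_subset)
  have sub: "A \<subseteq> elems N" "B \<subseteq> elems N"
    using partial_isoD(2)[OF p] unfolding A_def B_def by auto
  have "(x, y) \<in> less_rel N" if "x \<in> A" "y \<in> B" for x y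
  proof -
    from that obtain c c' where "(c, x) \<in> p" "(c, a) \<in> less_rel M" "(c', y) \<in> p" "(a, c') \<in> less_rel M"
      unfolding A_def B_def by auto
    then show ?thesis using partial_isoD(4)[OF p] linear_lorderD(2)[OF M] by blast
  qed
  from unbounded_dense_between[OF N fin sub this]
  obtain b where b: "b \<in> elems N" "\<forall>x\<in>A. (x, b) \<in> less_rel N" "\<forall>y\<in>B. (b, y) \<in> less_rel N"
    by blast
  have *: "a \<noteq> c \<and> b \<noteq> d \<and> ((a, c) \<in> less_rel M \<longleftrightarrow> (b, d) \<in> less_rel N) \<and>
      ((c, a) \<in> less_rel M \<longleftrightarrow> (d, b) \<in> less_rel N)" if "(c, d) \<in> p" for c d
  proof -
    have "a \<noteq> c" using False that by blast
    moreover have "c \<in> elems M" using that partial_isoD(2)[OF p] by blast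
    ultimately consider "(a, c) \<in> less_rel M" | "(c, a) \<in> less_rel M"
      using linear_lorderD(4)[OF M a] by blast
    then show ?thesis
    proof cases
      case 1
      then have "d \<in> B" unfolding B_def using that by force
      then have "(b, d) \<in> less_rel N" using b(3) by blast
      then show ?thesis using 1 linear_lorderD(2,3)[OF M] linear_lorderD(2,3)[OF N(1)] by metis
    next
      case 2
      then have "d \<in> A" unfolding A_def using that by force
      then have "(d, b) \<in> less_rel N" using b(2) by blast
      then show ?thesis using 2 linear_lorderD(2,3)[OF M] linear_lorderD(2,3)[OF N(1)] by metis
    qed
  qed
  have "partial_iso M N (insert (a, b) p)"
  proof (rule partial_isoI)
    show "finite (insert (a, b) p)" using partial_isoD(1)[OF p] by simp
    show "insert (a, b) p \<subseteq> elems M \<times> elems N" using partial_isoD(2)[OF p] a b(1) by simp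
    fix a' b' c d assume "(a', b') \<in> insert (a, b) p" "(c, d) \<in> insert (a, b) p"
    then consider "a' = a" "b' = b" "c = a" "d = b" | "a' = a" "b' = b" "(c, d) \<in> p"
      | "(a', b') \<in> p" "c = a" "d = b" | "(a', b') \<in> p" "(c, d) \<in> p" by blast
    then have "(a' = c \<longleftrightarrow> b' = d) \<and> ((a', c) \<in> less_rel M \<longleftrightarrow> (b', d) \<in> less_rel N)"
    proof cases
      case 1
      then show ?thesis using linear_lorderD(3)[OF M] linear_lorderD(3)[OF N(1)] by simp
    next
      case 2
      then show ?thesis using *[of c d] by simp
    next
      case 3
      then show ?thesis using *[of a' b'] by auto
    next
      case 4
      then show ?thesis using partial_isoD(3,4)[OF p] by simp
    qed
    then show "a' = c \<longleftrightarrow> b' = d" "(a', c) \<in> less_rel M \<longleftrightarrow> (b', d) \<in> less_rel N" by blast+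
  qed
  then show ?thesis by (intro exI[of _ "insert (a, b) p"]) auto
qed

lemma partial_iso_extend2:
  assumes M: "linear_lorder M" "unbounded_dense M" and N: "linear_lorder N" "unbounded_dense N"
    and p: "partial_iso M N p" and "a \<in> elems M" "b \<in> elems N"
  shows "\<exists>q. partial_iso M N q \<and> p \<subseteq> q \<and> a \<in> Domain q \<and> b \<in> Range q"
proof -
  obtain q where q: "partial_iso M N q" "p \<subseteq> q" "a \<in> Domain q"
    using partial_iso_extend[OF M(1) N p assms(6)] by blast
  obtain r where r: "partial_iso N M r" "q\<inverse> \<subseteq> r" "b \<in> Domain r"
    using partial_iso_extend[OF N(1) M partial_iso_converse[OF q(1)] assms(7)] by blast
  have "q \<subseteq> r\<inverse>" using r(2) by auto
  then show ?thesis
    using q(2,3) r(3) partial_iso_converse[OF r(1)] by (intro exI[of _ "r\<inverse>"]) auto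
qed

lemma unbounded_dense_unique:
  assumes M: "linear_lorder M" "unbounded_dense M" "countable (elems M)"
    and N: "linear_lorder N" "unbounded_dense N" "countable (elems N)"
  shows "M \<cong> N"
proof -
  have ne: "elems M \<noteq> {}" "elems N \<noteq> {}" using M(2) N(2) unfolding unbounded_dense_def by auto
  define a where "a = from_nat_into (elems M)"
  define b where "b = from_nat_into (elems N)"
  have ab: "range a = elems M" "range b = elems N"
    unfolding a_def b_def using ne M(3) N(3) by (simp_all add: range_from_nat_into)
  have "\<exists>p. \<forall>n. partial_iso M N (p n) \<and> (p n \<subseteq> p (Suc n) \<and> a n \<in> Domain (p (Suc n)) \<and> b n \<in> Range (p (Suc n)))"
  proof (rule dependent_nat_choice)
    show "\<exists>p. partial_iso M N p" by (rule exI[of _ "{}"]) (simp add: partial_iso_def)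
    show "\<exists>q. partial_iso M N q \<and> p \<subseteq> q \<and> a n \<in> Domain q \<and> b n \<in> Range q"
      if "partial_iso M N p" for p n
      using partial_iso_extend2[OF M(1,2) N(1,2) that] ab by blast
  qed
  then obtain p where p: "\<And>n. partial_iso M N (p n)" "\<And>n. p n \<subseteq> p (Suc n)"
    "\<And>n. a n \<in> Domain (p (Suc n))" "\<And>n. b n \<in> Range (p (Suc n))" by blast
  define g where "g = (\<Union>n. p n)"
  have mono: "p m \<subseteq> p n" if "m \<le> n" for m n
    using lift_Suc_mono_le[of p] p(2) that by blast
  have both: "\<exists>n. x \<in> p n \<and> y \<in> p n" if "x \<in> g" "y \<in> g" for x y
  proof -
    obtain m n where "x \<in> p m" "y \<in> p n" using \<open>x \<in> g\<close> \<open>y \<in> g\<close> unfolding g_def by blast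
    then show ?thesis using mono[of m "max m n"] mono[of n "max m n"] by auto
  qed
  have g: "(x = x' \<longleftrightarrow> y = y') \<and> ((x, x') \<in> less_rel M \<longleftrightarrow> (y, y') \<in> less_rel N)"
    if "(x, y) \<in> g" "(x', y') \<in> g" for x y x' y'
    using both[OF that] partial_isoD(3,4)[OF p(1)] by blast
  have gsub: "g \<subseteq> elems M \<times> elems N" unfolding g_def using partial_isoD(2)[OF p(1)] by blast
  have dom: "Domain g = elems M"
  proof
    show "elems M \<subseteq> Domain g"
    proof
      fix x assume "x \<in> elems M"
      then obtain n where "x = a n" using ab by blast
      then show "x \<in> Domain g" using p(3)[of n] unfolding g_def by blast
    qed
  qed (use gsub in auto)
  have ran: "Range g = elems N"
  proof
    show "elems N \<subseteq> Range g"
    proof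
      fix x assume "x \<in> elems N"
      then obtain n where "x = b n" using ab by blast
      then show "x \<in> Range g" using p(4)[of n] unfolding g_def by blast
    qed
  qed (use gsub in auto)
  define f where "f x = (SOME y. (x, y) \<in> g)" for x
  have f: "(x, f x) \<in> g" if "x \<in> elems M" for x
    unfolding f_def using that dom by (metis Domain.cases someI_ex)
  have "bij_betw f (elems M) (elems N)"
  proof (rule bij_betw_imageI)
    show "inj_on f (elems M)" using f g by (metis inj_onI)
    show "f ` elems M = elems N"
    proof
      show "elems N \<subseteq> f ` elems M"
      proof
        fix y assume "y \<in> elems N"
        then obtain x where xy: "(x, y) \<in> g" using ran by blast
        then have "x \<in> elems M" using gsub by blast
        then show "y \<in> f ` elems M" using f g[OF xy] by blast
      qed
    qed (use f gsub in blast)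
  qed
  moreover have "(x, y) \<in> less_rel M \<longleftrightarrow> (f x, f y) \<in> less_rel N" if "x \<in> elems M" "y \<in> elems M" for x y
    using g f that by blast
  ultimately show ?thesis unfolding same_order_type_def by blast
qed

lemma linear_eta: "linear_lorder \<eta>"
  by (rule linear_lorderI) (auto simp: eta_order_def)

lemma unbounded_dense_eta: "unbounded_dense \<eta>"
  unfolding unbounded_dense_def eta_order_def
  by (auto intro: dense gt_ex lt_ex)

text \<open>Removing \<open>b\<close> leaves an order without a least element, since density gives a
  point between \<open>b\<close> and any other one. Cantor's theorem identifies this remainder with
  \<open>\<eta>\<close>, and \<open>b\<close> is put back as the left summand.\<close>

lemma order_type_one_plus_eta:
  assumes M: "linear_lorder M" "countable (elems M)"
    and b: "b \<in> elems M" "\<And>x. x \<in> elems M \<Longrightarrow> (x, b) \<notin> less_rel M"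
    and no_max: "\<And>x. x \<in> elems M \<Longrightarrow> \<exists>y\<in>elems M. (x, y) \<in> less_rel M"
    and dense: "\<And>x y. (x, y) \<in> less_rel M \<Longrightarrow> \<exists>z. (x, z) \<in> less_rel M \<and> (z, y) \<in> less_rel M"
  shows "M \<cong> \<^bold>1 \<^bold>+ \<eta>"
proof -
  define N where "N = \<lparr>elems = elems M - {b}, less_rel = less_rel M \<inter> (elems M - {b}) \<times> (elems M - {b})\<rparr>"
  have N: "elems N = elems M - {b}"
    "(x, y) \<in> less_rel N \<longleftrightarrow> (x, y) \<in> less_rel M \<and> x \<in> elems M - {b} \<and> y \<in> elems M - {b}" for x y
    unfolding N_def by auto
  note MD = linear_lorderD[OF M(1)]
  have above: "(b, x) \<in> less_rel M" if "x \<in> elems M - {b}" for x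
    using MD(4)[of b x] b that by blast
  have "linear_lorder N"
  proof (rule linear_lorderI)
    show "x \<in> elems N \<and> y \<in> elems N" if "(x, y) \<in> less_rel N" for x y
      using that unfolding N by blast
    show "(x, z) \<in> less_rel N" if "(x, y) \<in> less_rel N" "(y, z) \<in> less_rel N" for x y z
      using that MD(2) unfolding N by blast
    show "(x, x) \<notin> less_rel N" for x using MD(3) unfolding N by blast
    show "(x, y) \<in> less_rel N \<or> (y, x) \<in> less_rel N" if "x \<in> elems N" "y \<in> elems N" "x \<noteq> y" for x y
      using that MD(4)[of x y] unfolding N by blast
  qed
  moreover have "unbounded_dense N"
    unfolding unbounded_dense_def
  proof (intro conjI ballI impI)
    show "elems N \<noteq> {}" using no_max[OF b(1)] MD(3) unfolding N by blast
    show "\<exists>y\<in>elems N. (x, y) \<in> less_rel N" if "x \<in> elems N" for x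
      using no_max[of x] b(2) that unfolding N by blast
    show "\<exists>y\<in>elems N. (y, x) \<in> less_rel N" if "x \<in> elems N" for x
      using dense[OF above, of x] MD(1,3) that unfolding N by blast
    show "\<exists>z\<in>elems N. (x, z) \<in> less_rel N \<and> (z, y) \<in> less_rel N"
      if "x \<in> elems N" "y \<in> elems N" "(x, y) \<in> less_rel N" for x y
      using dense[of x y] MD(1) b(2) that unfolding N by blast
  qed
  moreover have "countable (elems N)" using M(2) unfolding N by simp
  moreover have "countable (elems \<eta>)" by simp
  ultimately have "N \<cong> \<eta>"
    using unbounded_dense_unique linear_eta unbounded_dense_eta by blast
  then obtain f where "bij_betw f (elems N) (elems \<eta>)"
    "\<forall>x\<in>elems N. \<forall>y\<in>elems N. (x, y) \<in> less_rel N \<longleftrightarrow> (f x, f y) \<in> less_rel \<eta>"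
    unfolding same_order_type_def by blast
  then have f: "bij_betw f (elems N) UNIV"
    "\<And>x y. x \<in> elems N \<Longrightarrow> y \<in> elems N \<Longrightarrow> (x, y) \<in> less_rel N \<longleftrightarrow> f x < f y"
    by (simp_all add: eta_order_def)
  define h :: "'a \<Rightarrow> unit + rat" where "h x = (if x = b then Inl () else Inr (f x))" for x
  have "x \<in> elems (\<^bold>1 \<^bold>+ \<eta>)" for x
    by (cases x) (auto simp: order_sum_def one_order_def eta_order_def)
  then have sum: "elems (\<^bold>1 \<^bold>+ \<eta>) = UNIV" by blast
  have "bij_betw h (elems M) UNIV"
  proof (rule bij_betw_imageI)
    show "inj_on h (elems M)"
      using bij_betw_imp_inj_on[OF f(1)] unfolding N by (auto simp: h_def inj_on_def)
    have "Inr q \<in> h ` elems M" for q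
    proof -
      have "q \<in> f ` elems N" using bij_betw_imp_surj_on[OF f(1)] by simp
      then show ?thesis unfolding N by (auto simp: h_def image_iff)
    qed
    moreover have "Inl u \<in> h ` elems M" for u using b(1) by (auto simp: h_def image_iff)
    ultimately show "h ` elems M = UNIV" by (metis UNIV_eq_I sum.exhaust)
  qed
  moreover have "(x, y) \<in> less_rel M \<longleftrightarrow> (h x, h y) \<in> less_rel (\<^bold>1 \<^bold>+ \<eta>)"
    if "x \<in> elems M" "y \<in> elems M" for x y
  proof (cases "x = b \<or> y = b")
    case True
    then show ?thesis
      using that above b MD(3)
      by (auto simp: h_def order_sum_def one_order_def eta_order_def)
  next
    case False
    then show ?thesis
      using that f(2)[of x y] unfolding N by (auto simp: h_def order_sum_def one_order_def eta_order_def)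
  qed
  ultimately show ?thesis unfolding same_order_type_def sum by blast
qed

section \<open>Blocks of a linear order\<close>

lemma closed_interval_commute: "closed_interval M x y = closed_interval M y x"
  unfolding closed_interval_def by blast

text \<open>Each \<open>w\<close> between \<open>x\<close> and \<open>z\<close> is comparable with
  \<open>y\<close>, hence lies between \<open>y\<close> and one of the two ends. This is what makes
  finite distance transitive.\<close>

lemma closed_interval_triangle:
  assumes M: "linear_lorder M" and y: "y \<in> elems M"
  shows "closed_interval M x z \<subseteq> closed_interval M x y \<union> closed_interval M y z"
proof
  fix w assume w: "w \<in> closed_interval M x z"
  then have "w \<in> elems M" unfolding closed_interval_def by blast
  then have "(w, y) \<in> (less_rel M)\<^sup>= \<or> (y, w) \<in> (less_rel M)\<^sup>="
    using linear_lorderD(4)[OF M _ y] by blast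
  then show "w \<in> closed_interval M x y \<union> closed_interval M y z"
    using w unfolding closed_interval_def by blast
qed

lemma closed_interval_less:
  assumes M: "linear_lorder M" and xy: "(x, y) \<in> less_rel M"
  shows "closed_interval M x y = {z. (x, z) \<in> (less_rel M)\<^sup>= \<and> (z, y) \<in> (less_rel M)\<^sup>=}"
proof -
  note D = linear_lorderD[OF M]
  have "\<not> ((y, z) \<in> (less_rel M)\<^sup>= \<and> (z, x) \<in> (less_rel M)\<^sup>=)" for z
    using xy D(2,3) by blast
  moreover have "z \<in> elems M" if "(x, z) \<in> (less_rel M)\<^sup>=" for z
    using that xy D(1) by blast
  ultimately show ?thesis unfolding closed_interval_def by blast
qed

lemma block_eqI:
  assumes M: "linear_lorder M" and xy: "x \<in> elems M" "y \<in> elems M"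
    and fin: "finite (closed_interval M x y)"
  shows "block M x = block M y"
proof -
  have "block M u \<subseteq> block M v"
    if "u \<in> elems M" "finite (closed_interval M v u)" for u v
  proof
    fix z assume "z \<in> block M u"
    then have z: "z \<in> elems M" "finite (closed_interval M u z)" unfolding block_def by auto
    have "finite (closed_interval M v z)"
      by (rule finite_subset[OF closed_interval_triangle[OF M that(1)]]) (simp add: that z)
    then show "z \<in> block M v" using z(1) unfolding block_def by blast
  qed
  then show ?thesis using xy fin closed_interval_commute[of M x y] by (metis subset_antisym)
qed

lemma block_self:
  assumes M: "linear_lorder M" and x: "x \<in> elems M"
  shows "x \<in> block M x"
proof -
  have "closed_interval M x x \<subseteq> {x}"
    using linear_lorderD(2,3)[OF M] unfolding closed_interval_def by blast
  then show ?thesis using x finite_subset unfolding block_def by blast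
qed

text \<open>Reduces the comparison of blocks to one pair of representatives. If \<open>u\<close> and
  \<open>v\<close> from the two blocks were in the wrong order, the intervals from \<open>x\<close>
  to \<open>u\<close> and from \<open>y\<close> to \<open>v\<close> would together cover the
  interval from \<open>x\<close> to \<open>y\<close>, which would then be finite.\<close>

lemma condensation_less_iff:
  assumes M: "linear_lorder M" and xy: "x \<in> elems M" "y \<in> elems M"
  shows "(block M x, block M y) \<in> less_rel (c\<^sub>F M) \<longleftrightarrow>
    (x, y) \<in> less_rel M \<and> infinite (closed_interval M x y)"
proof
  assume "(block M x, block M y) \<in> less_rel (c\<^sub>F M)"
  then have less: "\<And>u v. u \<in> block M x \<Longrightarrow> v \<in> block M y \<Longrightarrow> (u, v) \<in> less_rel M"
    unfolding finite_condensation_def by auto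
  have "infinite (closed_interval M x y)"
  proof
    assume "finite (closed_interval M x y)"
    then have "y \<in> block M x" using xy unfolding block_def by blast
    then show False using less block_self[OF M xy(2)] linear_lorderD(3)[OF M] by blast
  qed
  then show "(x, y) \<in> less_rel M \<and> infinite (closed_interval M x y)"
    using less block_self[OF M] xy by blast
next
  assume *: "(x, y) \<in> less_rel M \<and> infinite (closed_interval M x y)"
  have "(u, v) \<in> less_rel M" if "u \<in> block M x" "v \<in> block M y" for u v
  proof (rule ccontr)
    assume "(u, v) \<notin> less_rel M"
    have u: "u \<in> elems M" "finite (closed_interval M x u)"
      and v: "v \<in> elems M" "finite (closed_interval M y v)"
      using that unfolding block_def by auto
    have vu: "(v, u) \<in> (less_rel M)\<^sup>="
      using linear_lorderD(4)[OF M u(1) v(1)] \<open>(u, v) \<notin> less_rel M\<close> by blast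
    have "closed_interval M x y \<subseteq> closed_interval M x u \<union> closed_interval M y v"
    proof
      fix z assume "z \<in> closed_interval M x y"
      then have z: "(x, z) \<in> (less_rel M)\<^sup>=" "(z, y) \<in> (less_rel M)\<^sup>="
        using closed_interval_less[OF M] * by auto
      then have "z \<in> elems M" using linear_lorderD(1)[OF M] xy by blast
      then consider "(z, u) \<in> (less_rel M)\<^sup>=" | "(u, z) \<in> less_rel M"
        using linear_lorderD(4)[OF M _ u(1)] by blast
      then show "z \<in> closed_interval M x u \<union> closed_interval M y v"
      proof cases
        case 1
        then show ?thesis using z \<open>z \<in> elems M\<close> unfolding closed_interval_def by blast
      next
        case 2
        then have "(v, z) \<in> less_rel M" using vu linear_lorderD(2)[OF M] by blast
        then show ?thesis using z \<open>z \<in> elems M\<close> unfolding closed_interval_def by blast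
      qed
    qed
    then show False using * u(2) v(2) finite_subset by blast
  qed
  then show "(block M x, block M y) \<in> less_rel (c\<^sub>F M)"
    using xy unfolding finite_condensation_def by auto
qed


section \<open>Cohesive powers of computable copies of \<open>\<omega>\<close>\<close>

instance recf :: countable by countable_datatype

lemma countable_partial_computable: "countable {\<phi>. partial_computable \<phi>}"
proof (rule countable_subset)
  define val where "val f x = (if \<exists>y. eval f [x] y then Some (SOME y. eval f [x] y) else None)" for f x
  show "{\<phi>. partial_computable \<phi>} \<subseteq> range val"
  proof
    fix \<phi> assume "\<phi> \<in> {\<phi>. partial_computable \<phi>}"
    then obtain f where f: "\<And>x y. eval f [x] y \<longleftrightarrow> \<phi> x = Some y"
      unfolding partial_computable_def by auto
    have "\<phi> x = val f x" for x
      unfolding val_def f by (cases "\<phi> x") auto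
    then show "\<phi> \<in> range val" by blast
  qed
qed simp

text \<open>\<open>rank\<close> is merely an isomorphism and may be noncomputable. Statements about
  ranks must be rewritten in terms of \<open>less_rel L\<close> before they can enter a
  \<open>sigma1\<close> predicate.\<close>

locale omega_power =
  fixes L :: "nat lorder" and C :: "nat set" and rank :: "nat \<Rightarrow> nat"
  assumes less_sub: "less_rel L \<subseteq> elems L \<times> elems L"
    and comp_less: "computable_rel (less_rel L)"
    and bij_rank: "bij_betw rank (elems L) UNIV"
    and less_iff: "\<And>x y. x \<in> elems L \<Longrightarrow> y \<in> elems L \<Longrightarrow> (x, y) \<in> less_rel L \<longleftrightarrow> rank x < rank y"
    and C: "cohesive C" "co_ce_set C"
begin

abbreviation P :: "(nat \<Rightarrow> nat option) set" where
  "P \<equiv> power_funs C L"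

abbreviation M :: "(nat \<Rightarrow> nat option) set lorder" where
  "M \<equiv> cohesive_power C L"

text \<open>Equivalently, \<open>a\<close> is below \<open>b\<close> with at least \<open>k\<close>
  elements strictly between them; \<open>gap 0\<close> is the order itself.\<close>

definition gap :: "nat \<Rightarrow> nat \<Rightarrow> nat \<Rightarrow> bool" where
  "gap k a b \<longleftrightarrow> a \<in> elems L \<and> b \<in> elems L \<and> rank a + k < rank b"

text \<open>Semidecidability of \<open>gap\<close> rests on searching for elements in between; their exact number
  need not be computable.\<close>

lemma gap_iff:
  "gap k a b \<longleftrightarrow> (a, b) \<in> less_rel L \<and>
    (\<exists>s. k \<le> card {l. l < s \<and> (a, l) \<in> less_rel L \<and> (l, b) \<in> less_rel L})"
proof (cases "(a, b) \<in> less_rel L")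
  case True
  then have ab: "a \<in> elems L" "b \<in> elems L" "rank a < rank b"
    using less_sub less_iff by auto
  define B where "B = {l. (a, l) \<in> less_rel L \<and> (l, b) \<in> less_rel L}"
  have B: "l \<in> B \<longleftrightarrow> l \<in> elems L \<and> rank a < rank l \<and> rank l < rank b" for l
    unfolding B_def using ab less_sub less_iff by blast
  have "bij_betw rank B {rank a<..<rank b}"
  proof (rule bij_betw_imageI)
    show "inj_on rank B"
      using bij_betw_imp_inj_on[OF bij_rank] B by (auto intro: inj_on_subset)
    show "rank ` B = {rank a<..<rank b}"
    proof (intro subset_antisym subsetI)
      show "x \<in> {rank a<..<rank b}" if "x \<in> rank ` B" for x using that B by auto
      fix x assume x: "x \<in> {rank a<..<rank b}"
      obtain l where "l \<in> elems L" "x = rank l" using bij_betw_imp_surj_on[OF bij_rank] by blast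
      then show "x \<in> rank ` B" using x B by auto
    qed
  qed
  then have card: "card B = rank b - Suc (rank a)" and fin: "finite B"
    using bij_betw_same_card bij_betw_finite by force+
  have sub: "{l. l < s \<and> (a, l) \<in> less_rel L \<and> (l, b) \<in> less_rel L} = {l\<in>B. l < s}" for s
    unfolding B_def by blast
  have "(\<exists>s. k \<le> card {l\<in>B. l < s}) \<longleftrightarrow> k \<le> card B"
  proof
    assume "\<exists>s. k \<le> card {l\<in>B. l < s}"
    then obtain s where "k \<le> card {l\<in>B. l < s}" by blast
    also have "\<dots> \<le> card B" using fin by (intro card_mono) auto
    finally show "k \<le> card B" .
  next
    assume "k \<le> card B"
    moreover obtain s where "\<forall>l\<in>B. l < s" using fin finite_nat_set_iff_bounded by blast
    then have "{l\<in>B. l < s} = B" by blast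
    ultimately show "\<exists>s. k \<le> card {l\<in>B. l < s}" by metis
  qed
  then show ?thesis using True ab card unfolding sub gap_def by auto
next
  case False
  then show ?thesis using less_iff unfolding gap_def by auto
qed

lemma sigma1_gap:
  assumes "computable_fun n K" "computable_fun n A" "computable_fun n B"
  shows "sigma1 n (\<lambda>e. gap (K e) (A e) (B e))"
proof -
  have *: "computable_fun (Suc n) (\<lambda>e. F (\<lambda>i. e (Suc i)))"
    "computable_fun (Suc (Suc n)) (\<lambda>e. F (\<lambda>i. e (Suc (Suc i))))"
    if "computable_fun n F" for F
    using computable_fun_subst[OF that, of "Suc n" "\<lambda>i e. e (Suc i)"]
      computable_fun_subst[OF that, of "Suc (Suc n)" "\<lambda>i e. e (Suc (Suc i))"]
    by (simp_all add: computable_fun_var)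
  show ?thesis
    unfolding gap_iff
    by (intro sigma1_conj sigma1_ex sigma1_computable computable_intros comp_less assms
        *(1)[OF assms(1)] *(2)[OF assms(2)] *(2)[OF assms(3)]) auto
qed

section \<open>Ranks along \<open>C\<close> and the order of the power\<close>

definition r :: "(nat \<Rightarrow> nat option) \<Rightarrow> nat \<Rightarrow> nat" where
  "r \<phi> n = rank (the (\<phi> n))"

text \<open>Where \<open>\<phi>\<close> diverges, \<open>r \<phi>\<close> is unspecified; this lemma
  makes such arguments negligible along \<open>C\<close>.\<close>

lemma power_funs_value: "\<phi> \<in> P \<Longrightarrow> \<forall>\<^sub>F n in along C. \<exists>a\<in>elems L. \<phi> n = Some a"
  unfolding power_funs_def almost_subset_along by (auto elim!: eventually_mono simp: ran_def)

lemma partial_computable_power: "\<phi> \<in> P \<Longrightarrow> partial_computable \<phi>"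
  unfolding power_funs_def by blast

text \<open>The inequality of ranks refers to \<open>rank\<close> and to unspecified values, so
  cohesiveness is applied to the semidecidable predicate \<open>W\<close> instead, which agrees with
  it almost everywhere on \<open>C\<close>.\<close>

lemma eventually_gap_dichotomy:
  assumes "\<phi> \<in> P" "\<psi> \<in> P"
  shows "(\<forall>\<^sub>F n in along C. r \<phi> n + k < r \<psi> n) \<or> (\<forall>\<^sub>F n in along C. \<not> r \<phi> n + k < r \<psi> n)"
proof -
  define W where "W n \<longleftrightarrow> (\<exists>a. \<phi> n = Some a \<and> (\<exists>b. \<psi> n = Some b \<and> gap k a b))" for n
  have "sigma1 1 (\<lambda>e. W (e 0))"
    unfolding W_def
    by (intro sigma1_ex sigma1_conj sigma1_graph sigma1_gap partial_computable_power assms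
        computable_fun_var computable_fun_const) auto
  then have "(\<forall>\<^sub>F n in along C. W n) \<or> (\<forall>\<^sub>F n in along C. \<not> W n)"
    by (rule cohesive_dichotomy[OF C(1)])
  moreover have "\<forall>\<^sub>F n in along C. W n \<longleftrightarrow> r \<phi> n + k < r \<psi> n"
    using power_funs_value[OF assms(1)] power_funs_value[OF assms(2)]
    by eventually_elim (auto simp: W_def r_def gap_def)
  ultimately show ?thesis
  proof (elim disjE)
    assume eq: "\<forall>\<^sub>F n in along C. W n \<longleftrightarrow> r \<phi> n + k < r \<psi> n"
    {
      assume "\<forall>\<^sub>F n in along C. W n"
      with eq have "\<forall>\<^sub>F n in along C. r \<phi> n + k < r \<psi> n" by eventually_elim blast
      then show ?thesis ..
    next
      assume "\<forall>\<^sub>F n in along C. \<not> W n"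
      with eq have "\<forall>\<^sub>F n in along C. \<not> r \<phi> n + k < r \<psi> n" by eventually_elim blast
      then show ?thesis ..
    }
  qed
qed

lemma power_less_iff:
  assumes "\<phi> \<in> P" "\<psi> \<in> P"
  shows "power_less C L \<phi> \<psi> \<longleftrightarrow> (\<forall>\<^sub>F n in along C. r \<phi> n < r \<psi> n)"
  unfolding power_less_def almost_subset_along
  by (rule eventually_cong[OF eventually_conj[OF power_funs_value[OF assms(1)] power_funs_value[OF assms(2)]]])
    (auto simp: r_def less_iff)

lemma power_eq_iff:
  assumes "\<phi> \<in> P" "\<psi> \<in> P"
  shows "(\<phi>, \<psi>) \<in> power_eq C L \<longleftrightarrow> (\<forall>\<^sub>F n in along C. r \<phi> n = r \<psi> n)"
proof -
  have "C \<subseteq>* {x. \<exists>a. \<phi> x = Some a \<and> \<psi> x = Some a} \<longleftrightarrow> (\<forall>\<^sub>F n in along C. r \<phi> n = r \<psi> n)"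
    unfolding almost_subset_along
    by (rule eventually_cong[OF eventually_conj[OF power_funs_value[OF assms(1)] power_funs_value[OF assms(2)]]])
      (auto simp: r_def dest: inj_onD[OF bij_betw_imp_inj_on[OF bij_rank]])
  then show ?thesis using assms by (simp add: power_eq_def)
qed

definition cls :: "(nat \<Rightarrow> nat option) \<Rightarrow> (nat \<Rightarrow> nat option) set" where
  "cls \<phi> = power_eq C L `` {\<phi>}"

lemma elems_power: "elems M = cls ` P"
  by (auto simp: cohesive_power_def quotient_def cls_def)

lemma cls_eq_iff: "\<phi> \<in> P \<Longrightarrow> \<psi> \<in> P \<Longrightarrow> cls \<phi> = cls \<psi> \<longleftrightarrow> (\<forall>\<^sub>F n in along C. r \<phi> n = r \<psi> n)"
  unfolding cls_def using eq_equiv_class_iff[OF equiv_power_eq] power_eq_iff by blast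

lemma cls_less_iff:
  assumes "\<phi> \<in> P" "\<psi> \<in> P"
  shows "(cls \<phi>, cls \<psi>) \<in> less_rel M \<longleftrightarrow> (\<forall>\<^sub>F n in along C. r \<phi> n < r \<psi> n)"
proof -
  have "(cls \<phi>, cls \<psi>) \<in> less_rel M \<longleftrightarrow> (\<exists>\<phi>'\<in>cls \<phi>. \<exists>\<psi>'\<in>cls \<psi>. power_less C L \<phi>' \<psi>')"
    using assms elems_power by (auto simp: cohesive_power_def)
  also have "\<dots> \<longleftrightarrow> power_less C L \<phi> \<psi>"
  proof
    assume "\<exists>\<phi>'\<in>cls \<phi>. \<exists>\<psi>'\<in>cls \<psi>. power_less C L \<phi>' \<psi>'"
    then obtain \<phi>' \<psi>' where "(\<phi>, \<phi>') \<in> power_eq C L" "(\<psi>, \<psi>') \<in> power_eq C L" "power_less C L \<phi>' \<psi>'"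
      unfolding cls_def by blast
    then show "power_less C L \<phi> \<psi>"
      using power_less_cong equivE[OF equiv_power_eq] by (metis symD)
  next
    assume "power_less C L \<phi> \<psi>"
    then show "\<exists>\<phi>'\<in>cls \<phi>. \<exists>\<psi>'\<in>cls \<psi>. power_less C L \<phi>' \<psi>'"
      unfolding cls_def using assms equiv_class_self[OF equiv_power_eq] by blast
  qed
  finally show ?thesis using power_less_iff[OF assms] by simp
qed

lemma less_power_elems: "(x, y) \<in> less_rel M \<Longrightarrow> x \<in> elems M \<and> y \<in> elems M"
  by (auto simp: cohesive_power_def)

lemma not_eventually_both: "(\<forall>\<^sub>F n in along C. A n) \<Longrightarrow> \<not> (\<forall>\<^sub>F n in along C. \<not> A n)"
  using eventually_conj[of A "along C" "\<lambda>n. \<not> A n"] along_neq_bot[OF C(1)] by auto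

lemma linear_power: "linear_lorder M"
proof (rule linear_lorderI)
  show "(x, z) \<in> less_rel M" if xyz: "(x, y) \<in> less_rel M" "(y, z) \<in> less_rel M" for x y z
  proof -
    obtain \<phi> \<psi> \<theta> where *: "\<phi> \<in> P" "x = cls \<phi>" "\<psi> \<in> P" "y = cls \<psi>" "\<theta> \<in> P" "z = cls \<theta>"
      using less_power_elems[OF xyz(1)] less_power_elems[OF xyz(2)] unfolding elems_power by blast
    have "\<forall>\<^sub>F n in along C. r \<phi> n < r \<psi> n" "\<forall>\<^sub>F n in along C. r \<psi> n < r \<theta> n"
      using xyz * cls_less_iff by auto
    then have "\<forall>\<^sub>F n in along C. r \<phi> n < r \<theta> n" by eventually_elim simp
    then show ?thesis using * cls_less_iff by simp
  qed
  show "(x, x) \<notin> less_rel M" for x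
  proof
    assume xx: "(x, x) \<in> less_rel M"
    then obtain \<phi> where "\<phi> \<in> P" "x = cls \<phi>" using less_power_elems[OF xx] unfolding elems_power by blast
    then show False using xx cls_less_iff along_neq_bot[OF C(1)] by simp
  qed
  show "(x, y) \<in> less_rel M \<or> (y, x) \<in> less_rel M" if xy: "x \<in> elems M" "y \<in> elems M" "x \<noteq> y" for x y
  proof (rule ccontr)
    assume neg: "\<not> ?thesis"
    obtain \<phi> \<psi> where *: "\<phi> \<in> P" "x = cls \<phi>" "\<psi> \<in> P" "y = cls \<psi>"
      using xy(1,2) unfolding elems_power by blast
    \<comment> \<open>The dichotomy with \<open>k = 0\<close>, used in both directions: if neither
      strict inequality holds eventually, both fail eventually and the ranks agree.\<close>
    have "\<forall>\<^sub>F n in along C. \<not> r \<phi> n < r \<psi> n" "\<forall>\<^sub>F n in along C. \<not> r \<psi> n < r \<phi> n"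
      using neg * cls_less_iff eventually_gap_dichotomy[of \<phi> \<psi> 0] eventually_gap_dichotomy[of \<psi> \<phi> 0]
      by auto
    then have "\<forall>\<^sub>F n in along C. r \<phi> n = r \<psi> n" by eventually_elim simp
    then show False using * cls_eq_iff xy(3) by simp
  qed
qed (rule less_power_elems)

section \<open>Unbounded distance of ranks\<close>

definition far :: "(nat \<Rightarrow> nat option) \<Rightarrow> (nat \<Rightarrow> nat option) \<Rightarrow> bool" where
  "far \<phi> \<psi> \<longleftrightarrow> (\<forall>k. \<forall>\<^sub>F n in along C. r \<phi> n + k < r \<psi> n)"

lemma far_trans:
  assumes "far \<phi> \<psi>" "far \<psi> \<theta>" shows "far \<phi> \<theta>"
  unfolding far_def
proof
  fix k
  have "\<forall>\<^sub>F n in along C. r \<phi> n + k < r \<psi> n" "\<forall>\<^sub>F n in along C. r \<psi> n + 0 < r \<theta> n"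
    using assms unfolding far_def by blast+
  then show "\<forall>\<^sub>F n in along C. r \<phi> n + k < r \<theta> n" by eventually_elim simp
qed

lemma not_far_self: "\<not> far \<phi> \<phi>"
  using along_neq_bot[OF C(1)] by (auto simp: far_def)

lemma power_funsI:
  assumes "partial_computable \<theta>" "\<forall>\<^sub>F n in along C. \<exists>l. \<theta> n = Some l \<and> Q n l"
    "\<And>n l. \<theta> n = Some l \<Longrightarrow> l \<in> elems L"
  shows "\<theta> \<in> P"
proof -
  have "\<forall>\<^sub>F n in along C. n \<in> dom \<theta>" using assms(2) by eventually_elim auto
  then show ?thesis
    using assms(1,3) unfolding power_funs_def almost_subset_along by (auto simp: ran_def)
qed

lemma far_dense:
  assumes \<phi>: "\<phi> \<in> P" and \<psi>: "\<psi> \<in> P" and far: "far \<phi> \<psi>"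
  shows "\<exists>\<theta>\<in>P. far \<phi> \<theta> \<and> far \<theta> \<psi>"
proof -
  define R where "R k n l \<longleftrightarrow> (\<exists>a. \<phi> n = Some a \<and> gap k a l) \<and> (\<exists>b. \<psi> n = Some b \<and> gap k l b)" for k n l
  have sigma1_R: "sigma1 3 (\<lambda>e. R (e 0) (e 1) (e 2))"
    unfolding R_def
    by (intro sigma1_ex sigma1_conj sigma1_graph sigma1_gap partial_computable_power assms
        computable_fun_var) auto
  have anti_R: "R k n l" if "R (Suc k) n l" for k n l
    using that unfolding R_def gap_def by fastforce
  have ex_R: "\<forall>\<^sub>F n in along C. \<exists>l. R k n l" for k
  proof -
    \<comment> \<open>The value \<open>l\<close> of rank \<open>rank a + k + 1\<close> clears
      \<open>a\<close> by more than \<open>k\<close>; the gap \<open>2 * k + 1\<close> is what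
      leaves it more than \<open>k\<close> below \<open>b\<close>.\<close>
    have "\<forall>\<^sub>F n in along C. r \<phi> n + (2 * k + 1) < r \<psi> n"
      using far unfolding far_def by blast
    then show ?thesis using power_funs_value[OF \<phi>] power_funs_value[OF \<psi>]
    proof eventually_elim
      case (elim n)
      then obtain a b where ab: "a \<in> elems L" "\<phi> n = Some a" "b \<in> elems L" "\<psi> n = Some b" by blast
      obtain l where "l \<in> elems L" "rank a + k + 1 = rank l"
        using bij_betw_imp_surj_on[OF bij_rank] by blast
      then have "R k n l" using ab elim(1) by (auto simp: R_def gap_def r_def)
      then show ?case by blast
    qed
  qed
  obtain \<theta> where \<theta>: "partial_computable \<theta>"
    "\<And>k. \<forall>\<^sub>F n in along C. \<exists>l. \<theta> n = Some l \<and> R k n l" "\<And>n l. \<theta> n = Some l \<Longrightarrow> \<exists>k. R k n l"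
    using cohesive_saturation[OF C sigma1_R anti_R ex_R] by blast
  have "\<theta> \<in> P" using \<theta>(3) by (intro power_funsI[OF \<theta>(1,2)]) (auto simp: R_def gap_def)
  moreover have "far \<phi> \<theta>" "far \<theta> \<psi>"
    unfolding far_def by (intro allI eventually_mono[OF \<theta>(2)]; force simp: R_def r_def gap_def)+
  ultimately show ?thesis by blast
qed

lemma far_above:
  assumes \<phi>: "\<phi> \<in> P"
  shows "\<exists>\<theta>\<in>P. far \<phi> \<theta>"
proof -
  define R where "R k n l \<longleftrightarrow> (\<exists>a. \<phi> n = Some a \<and> gap k a l)" for k n l
  have sigma1_R: "sigma1 3 (\<lambda>e. R (e 0) (e 1) (e 2))"
    unfolding R_def
    by (intro sigma1_ex sigma1_conj sigma1_graph sigma1_gap partial_computable_power assms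
        computable_fun_var) auto
  have anti_R: "R k n l" if "R (Suc k) n l" for k n l
    using that unfolding R_def gap_def by fastforce
  have ex_R: "\<forall>\<^sub>F n in along C. \<exists>l. R k n l" for k
    using power_funs_value[OF \<phi>]
  proof eventually_elim
    case (elim n)
    then obtain a where a: "a \<in> elems L" "\<phi> n = Some a" by blast
    obtain l where "l \<in> elems L" "rank a + k + 1 = rank l"
      using bij_betw_imp_surj_on[OF bij_rank] by blast
    then have "R k n l" using a by (auto simp: R_def gap_def)
    then show ?case by blast
  qed
  obtain \<theta> where \<theta>: "partial_computable \<theta>"
    "\<And>k. \<forall>\<^sub>F n in along C. \<exists>l. \<theta> n = Some l \<and> R k n l" "\<And>n l. \<theta> n = Some l \<Longrightarrow> \<exists>k. R k n l"
    using cohesive_saturation[OF C sigma1_R anti_R ex_R] by blast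
  have "\<theta> \<in> P" using \<theta>(3) by (intro power_funsI[OF \<theta>(1,2)]) (auto simp: R_def gap_def)
  moreover have "far \<phi> \<theta>"
    unfolding far_def by (intro allI eventually_mono[OF \<theta>(2)]; force simp: R_def r_def gap_def)+
  ultimately show ?thesis by blast
qed

lemma far_less: "\<phi> \<in> P \<Longrightarrow> \<psi> \<in> P \<Longrightarrow> far \<phi> \<psi> \<Longrightarrow> (cls \<phi>, cls \<psi>) \<in> less_rel M"
  unfolding far_def by (drule spec[of _ 0]) (simp add: cls_less_iff)

text \<open>Density of \<open>far\<close> rules out a finite interval of least cardinality.\<close>

lemma far_infinite:
  assumes "\<phi> \<in> P" "\<psi> \<in> P" "far \<phi> \<psi>"
  shows "infinite (closed_interval M (cls \<phi>) (cls \<psi>))"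
proof -
  \<comment> \<open>For an infinite interval \<open>card\<close> is 0 and the claim is immediate, so
    the induction only has to refute a finite one.\<close>
  define c where "c = card (closed_interval M (cls \<phi>) (cls \<psi>))"
  show ?thesis using assms c_def
  proof (induction c arbitrary: \<psi> rule: less_induct)
    case (less c)
    show ?case
    proof
      assume fin: "finite (closed_interval M (cls \<phi>) (cls \<psi>))"
      obtain \<theta> where \<theta>: "\<theta> \<in> P" "far \<phi> \<theta>" "far \<theta> \<psi>"
        using far_dense less.prems by blast
      note l = far_less[OF \<open>\<phi> \<in> P\<close> \<theta>(1,2)] far_less[OF \<theta>(1) \<open>\<psi> \<in> P\<close> \<theta>(3)]
        far_less[OF less.prems(1-3)]
      note D = linear_lorderD(2,3)[OF linear_power]
      have "closed_interval M (cls \<phi>) (cls \<theta>) \<subseteq> closed_interval M (cls \<phi>) (cls \<psi>)"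
        unfolding closed_interval_less[OF linear_power l(1)] closed_interval_less[OF linear_power l(3)]
        using D(1)[OF _ l(2)] l(2) by auto
      moreover have "cls \<psi> \<notin> closed_interval M (cls \<phi>) (cls \<theta>)"
        unfolding closed_interval_less[OF linear_power l(1)] using D(1)[OF l(2)] D(2) l(2) by auto
      moreover have "cls \<psi> \<in> closed_interval M (cls \<phi>) (cls \<psi>)"
        unfolding closed_interval_less[OF linear_power l(3)] using l(3) by blast
      ultimately have sub: "closed_interval M (cls \<phi>) (cls \<theta>) \<subset> closed_interval M (cls \<phi>) (cls \<psi>)"
        by blast
      then have "card (closed_interval M (cls \<phi>) (cls \<theta>)) < c"
        unfolding less.prems(4) by (rule psubset_card_mono[OF fin])
      then have "infinite (closed_interval M (cls \<phi>) (cls \<theta>))"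
        using less.IH less.prems(1) \<theta>(1,2) by blast
      then show False using sub fin finite_subset by blast
    qed
  qed
qed

text \<open>A class strictly inside uses up at least one unit of rank on either side, so both halves
  obey the bound \<open>k\<close>; with no such class the interval is its two endpoints. For
  \<open>k = 0\<close> the hypotheses contradict each other.\<close>

lemma bounded_gap_finite:
  assumes "\<phi> \<in> P" "\<psi> \<in> P" "(cls \<phi>, cls \<psi>) \<in> less_rel M"
    "\<forall>\<^sub>F n in along C. \<not> r \<phi> n + k < r \<psi> n"
  shows "finite (closed_interval M (cls \<phi>) (cls \<psi>))"
  using assms
proof (induction k arbitrary: \<phi> \<psi>)
  case 0
  then show ?case using cls_less_iff not_eventually_both[of "\<lambda>n. r \<phi> n < r \<psi> n"] by simp
next
  case (Suc k)
  show ?case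
  proof (cases "\<exists>z. (cls \<phi>, z) \<in> less_rel M \<and> (z, cls \<psi>) \<in> less_rel M")
    case True
    then obtain z where z: "(cls \<phi>, z) \<in> less_rel M" "(z, cls \<psi>) \<in> less_rel M" by blast
    then obtain \<theta> where "\<theta> \<in> P" "z = cls \<theta>"
      using less_power_elems[OF z(1)] unfolding elems_power by blast
    with z have \<theta>: "\<theta> \<in> P" "(cls \<phi>, cls \<theta>) \<in> less_rel M" "(cls \<theta>, cls \<psi>) \<in> less_rel M" by auto
    have l: "\<forall>\<^sub>F n in along C. r \<phi> n < r \<theta> n" "\<forall>\<^sub>F n in along C. r \<theta> n < r \<psi> n"
      using \<theta> cls_less_iff Suc.prems(1,2) by auto
    have "\<forall>\<^sub>F n in along C. \<not> r \<phi> n + k < r \<theta> n"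
      using l(2) Suc.prems(4) by eventually_elim simp
    then have "finite (closed_interval M (cls \<phi>) (cls \<theta>))"
      by (rule Suc.IH[OF Suc.prems(1) \<theta>(1,2)])
    moreover have "\<forall>\<^sub>F n in along C. \<not> r \<theta> n + k < r \<psi> n"
      using l(1) Suc.prems(4) by eventually_elim simp
    then have "finite (closed_interval M (cls \<theta>) (cls \<psi>))"
      by (rule Suc.IH[OF \<theta>(1) Suc.prems(2) \<theta>(3)])
    moreover have "cls \<theta> \<in> elems M" using \<theta>(1) elems_power by blast
    ultimately show ?thesis
      using closed_interval_triangle[OF linear_power] by (meson finite_UnI finite_subset)
  next
    case False
    then have "closed_interval M (cls \<phi>) (cls \<psi>) \<subseteq> {cls \<phi>, cls \<psi>}"
      unfolding closed_interval_less[OF linear_power Suc.prems(3)] by blast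
    then show ?thesis using finite_subset by blast
  qed
qed

text \<open>If \<open>far\<close> fails, some \<open>k\<close> is not eventually exceeded, and the
  dichotomy strengthens this to an eventual bound, to which \<open>bounded_gap_finite\<close>
  applies.\<close>

lemma far_iff:
  assumes "\<phi> \<in> P" "\<psi> \<in> P"
  shows "far \<phi> \<psi> \<longleftrightarrow> (cls \<phi>, cls \<psi>) \<in> less_rel M \<and> infinite (closed_interval M (cls \<phi>) (cls \<psi>))"
  using far_less[OF assms] far_infinite[OF assms] bounded_gap_finite[OF assms]
    eventually_gap_dichotomy[OF assms] unfolding far_def by blast

text \<open>The fact \<open>less\<close> translates the order of blocks into \<open>far\<close>,
  after which the order-theoretic conditions become statements about partial computable
  functions.\<close>

lemma condensation_type: "c\<^sub>F M \<cong> \<^bold>1 \<^bold>+ \<eta>"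
proof -
  define blk where "blk \<phi> = block M (cls \<phi>)" for \<phi>
  have elems: "elems (c\<^sub>F M) = blk ` P"
    by (auto simp: finite_condensation_def elems_power blk_def)
  have in_M: "cls \<phi> \<in> elems M" if "\<phi> \<in> P" for \<phi> using that elems_power by blast
  have less: "(blk \<phi>, blk \<psi>) \<in> less_rel (c\<^sub>F M) \<longleftrightarrow> far \<phi> \<psi>" if "\<phi> \<in> P" "\<psi> \<in> P" for \<phi> \<psi>
    unfolding blk_def using condensation_less_iff[OF linear_power in_M in_M] far_iff that by simp
  have in_less: "x \<in> elems (c\<^sub>F M) \<and> y \<in> elems (c\<^sub>F M)" if "(x, y) \<in> less_rel (c\<^sub>F M)" for x y
    using that by (auto simp: finite_condensation_def)
  obtain a where a: "a \<in> elems L" "rank a = 0"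
    using bij_betw_imp_surj_on[OF bij_rank] by (metis UNIV_I imageE)
  define bot where "bot = (\<lambda>_::nat. Some a)"
  have "partial_computable bot"
  proof -
    obtain f where f: "\<And>e. eval f (map e [0..<1]) a"
      using computable_fun_const[of 1 a] unfolding computable_fun_def by blast
    have "eval f [x] y \<longleftrightarrow> bot x = Some y" for x y
      using f[of "\<lambda>_. x"] eval_deterministic unfolding bot_def by auto
    then show ?thesis unfolding partial_computable_def by blast
  qed
  then have bot: "bot \<in> P"
    using a by (auto simp: power_funs_def bot_def almost_subset_def dom_def ran_def)
  \<comment> \<open>The constant value of \<open>bot\<close> has rank 0, so no rank lies strictly
    below it.\<close>
  have "\<not> far \<phi> bot" for \<phi>
    using along_neq_bot[OF C(1)] a by (auto simp: far_def bot_def r_def)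
  show ?thesis
  proof (rule order_type_one_plus_eta)
    show "linear_lorder (c\<^sub>F M)"
    proof (rule linear_lorderI)
      show "(x, z) \<in> less_rel (c\<^sub>F M)"
        if xyz: "(x, y) \<in> less_rel (c\<^sub>F M)" "(y, z) \<in> less_rel (c\<^sub>F M)" for x y z
      proof -
        obtain \<phi> \<psi> \<theta> where "\<phi> \<in> P" "x = blk \<phi>" "\<psi> \<in> P" "y = blk \<psi>" "\<theta> \<in> P" "z = blk \<theta>"
          using in_less[OF xyz(1)] in_less[OF xyz(2)] unfolding elems by blast
        then show ?thesis using xyz less far_trans by blast
      qed
      show "(x, x) \<notin> less_rel (c\<^sub>F M)" for x
        using in_less elems less not_far_self by (metis imageE)
      show "(x, y) \<in> less_rel (c\<^sub>F M) \<or> (y, x) \<in> less_rel (c\<^sub>F M)"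
        if xy: "x \<in> elems (c\<^sub>F M)" "y \<in> elems (c\<^sub>F M)" "x \<noteq> y" for x y
      proof (rule ccontr)
        assume neg: "\<not> ?thesis"
        obtain \<phi> \<psi> where *: "\<phi> \<in> P" "x = blk \<phi>" "\<psi> \<in> P" "y = blk \<psi>"
          using xy(1,2) unfolding elems by blast
        have ne: "cls \<phi> \<noteq> cls \<psi>" using * xy(3) by (auto simp: blk_def)
        \<comment> \<open>The two classes are comparable and neither is far from the other, so
          \<open>far_iff\<close> leaves only a finite interval, which forces equal blocks.\<close>
        have "finite (closed_interval M (cls \<phi>) (cls \<psi>))"
          using linear_lorderD(4)[OF linear_power in_M[OF *(1)] in_M[OF *(3)]] ne neg *
            less far_iff closed_interval_commute[of M "cls \<phi>" "cls \<psi>"] by metis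
        then show False using block_eqI[OF linear_power in_M in_M] * xy(3) by (simp add: blk_def)
      qed
    qed (rule in_less)
    have "countable P"
      using countable_partial_computable by (rule countable_subset[rotated]) (auto simp: power_funs_def)
    then show "countable (elems (c\<^sub>F M))" unfolding elems by simp
    show "blk bot \<in> elems (c\<^sub>F M)" using bot elems by blast
    show "(x, blk bot) \<notin> less_rel (c\<^sub>F M)" if "x \<in> elems (c\<^sub>F M)" for x
      using that elems less bot \<open>\<And>\<phi>. \<not> far \<phi> bot\<close> by auto
    show "\<exists>y\<in>elems (c\<^sub>F M). (x, y) \<in> less_rel (c\<^sub>F M)" if "x \<in> elems (c\<^sub>F M)" for x
    proof -
      from that obtain \<phi> where \<phi>: "\<phi> \<in> P" "x = blk \<phi>" unfolding elems by blast
      obtain \<theta> where \<theta>: "\<theta> \<in> P" "far \<phi> \<theta>" using far_above[OF \<phi>(1)] by blast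
      show ?thesis
        using \<theta> \<phi> less elems by (intro bexI[of _ "blk \<theta>"]) auto
    qed
    show "\<exists>z. (x, z) \<in> less_rel (c\<^sub>F M) \<and> (z, y) \<in> less_rel (c\<^sub>F M)"
      if xy: "(x, y) \<in> less_rel (c\<^sub>F M)" for x y
    proof -
      obtain \<phi> \<psi> where *: "\<phi> \<in> P" "x = blk \<phi>" "\<psi> \<in> P" "y = blk \<psi>"
        using in_less[OF xy] unfolding elems by blast
      then have "far \<phi> \<psi>" using xy less by simp
      then obtain \<theta> where "\<theta> \<in> P" "far \<phi> \<theta>" "far \<theta> \<psi>"
        using far_dense[OF *(1,3)] by blast
      then show ?thesis using less * by (intro exI[of _ "blk \<theta>"]) simp
    qed
  qed
qed

end

theorem theorem4p4:
  fixes L :: "nat lorder" and C :: "nat set"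
  assumes "computable_linear_order L"
    and "L \<cong> \<omega>"
    and "cohesive C"
    and "co_ce_set C"
  shows "c\<^sub>F (cohesive_power C L) \<cong> \<^bold>1 \<^bold>+ \<eta>"
proof -
  obtain rank where "bij_betw rank (elems L) (elems \<omega>)"
    "\<forall>x\<in>elems L. \<forall>y\<in>elems L. (x, y) \<in> less_rel L \<longleftrightarrow> (rank x, rank y) \<in> less_rel \<omega>"
    using assms(2) unfolding same_order_type_def by blast
  then interpret omega_power L C rank
    using assms by unfold_locales
      (auto simp: omega_order_def computable_linear_order_def linear_lorder_def)
  show ?thesis by (rule condensation_type)
qed

end
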